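(* Let $n\ge3$, $m\ge2$ be integers. The number $H_1(n,m)$ is bounded above by the mixed volume ${\rm MV}(\mathcal{A}_1,\{\boldsymbol{0}_{n-1}\}\cup\mathcal{A}_3,\ldots,\{\boldsymbol{0}_{n-1}\}\cup\mathcal{A}_n)$, where for $s\in\{1,3,\ldots,n\}$, $\mathcal{A}_s\subset\mathbb{N}^{n-1}$ is the support of the polynomial $\bar f_{1,s}$ (defined in the context) in the variables $(\rho,X_3,\ldots,X_n)$ with $\rho=R^2$. Moreover, $$\mathcal{A}_1=\bigcup_{t=1}^{m/2}\{(m/2-t,\boldsymbol{e}_{j_1j_2\cdots j_{2t-1}})\}\cup\{\boldsymbol{0}_{n-1}\},$$ $$\mathcal{A}_s=\bigcup_{t=1}^{m/2}\{(m/2-t,\boldsymbol{e}_{j_1j_2\cdots j_{2t}})\}\cup\{\bar{\boldsymbol{e}}_s\}\cup\{(m/2,\boldsymbol{0}_{n-2})\},\quad s=3,\ldots,n,$$ when $m\ge2$ is even, and $$\mathcal{A}_1=\bigcup_{t=1}^{(m-1)/2}\{((m-1)/2-t,\boldsymbol{e}_{j_1j_2\cdots j_{2t}})\}\cup\{\boldsymbol{0}_{n-1}\}\cup\{((m-1)/2,\boldsymbol{0}_{n-2})\},$$ $$\mathcal{A}_s=\bigcup_{t=1}^{(m+1)/2}\{((m+1)/2-t,\boldsymbol{e}_{j_1j_2\cdots j_{2t-1}})\}\cup\{\bar{\boldsymbol{e}}_s\},\quad s=3,\ldots,n,$$ when $m\ge3$ is odd.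
   Context: Consider the perturbed system (first order in $\varepsilon$) $$\dot{x}_1=a_1\varepsilon x_1-(b+b_1\varepsilon)x_2+\sum_{i_1+\cdots+i_n=m}p_{1,i_1,\ldots,i_n,0}\,x_1^{i_1}\cdots x_n^{i_n},$$ $$\dot{x}_2=(b+b_1\varepsilon)x_1+a_1\varepsilon x_2+\sum_{i_1+\cdots+i_n=m}p_{2,i_1,\ldots,i_n,0}\,x_1^{i_1}\cdots x_n^{i_n},$$ $$\dot{x}_s=c_{s,1}\varepsilon x_s+\sum_{i_1+\cdots+i_n=m}p_{s,i_1,\ldots,i_n,0}\,x_1^{i_1}\cdots x_n^{i_n},\quad s=3,\ldots,n,$$ with real parameters $a_1,b_1,b\neq0,c_{s,1},p_{s,i_1,\ldots,i_n,0}$. After $x_1=r\cos\theta$, $x_2=r\sin\theta$ ($r>0$), taking $\theta$ as independent variable and $(r,x_3,\ldots,x_n)=\varepsilon^{1/(m-1)}(R,X_3,\ldots,X_n)$, it becomes $dR/d\theta=\varepsilon F_1+\mathcal{O}(\varepsilon^2)$, $dX_s/d\theta=\varepsilon F_s+\mathcal{O}(\varepsilon^2)$, $s=3,\ldots,n$, with (sums over $i_1+\cdots+i_n=m$) $$F_1=\tfrac1b\Big(a_1R+\sum(p_{1,i_1,\ldots,i_n,0}\cos\theta+p_{2,i_1,\ldots,i_n,0}\sin\theta)(R\cos\theta)^{i_1}(R\sin\theta)^{i_2}X_3^{i_3}\cdots X_n^{i_n}\Big),$$ $$F_s=\tfrac1b\Big(c_{s,1}X_s+\sum p_{s,i_1,\ldots,i_n,0}(R\cos\theta)^{i_1}(R\sin\theta)^{i_2}X_3^{i_3}\cdots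 X_n^{i_n}\Big).$$ With $\boldsymbol{\eta}=(R,X_3,\ldots,X_n)$, the first-order averaged function is $\boldsymbol{f}_1=(f_{1,1},f_{1,3},\ldots,f_{1,n})$, $f_{1,s}(\boldsymbol{\eta})=\int_0^{2\pi}F_s(\theta,\boldsymbol{\eta})\,d\theta$. Define $\bar f_{1,1}$ by $f_{1,1}=\frac{R}{b}\bar f_{1,1}$ and $\bar f_{1,s}$ by $f_{1,s}=\frac1b\bar f_{1,s}$ for $s=3,\ldots,n$; these are polynomials in $\rho=R^2,X_3,\ldots,X_n$ whose coefficients are linear forms in the parameters, and their supports are taken with the parameters regarded as indeterminates (generic). $H_1(n,m)$ denotes the maximum number of limit cycles bifurcating from the origin that can be detected by the first-order averaging method, i.e. the maximum, over all real parameter values with $b\ne0$ and $\boldsymbol{f}_1\not\equiv0$, of the number of simple real zeros of $\boldsymbol{f}_1$ with $R>0$ (zeros at which $\det J_{\boldsymbol{f}_1}\neq 0$). Notation: $\boldsymbol{0}_N$ is the zero vector of length $N$. $\bar{\boldsymbol{e}}_s\in\mathbb{N}^{n-1}$ is the unit vector with $(s-1)$th entry equal to 1 (the exponent vector of $X_s$ in the variables $(\rho,X_3,\ldots,X_n)$). $\boldsymbol{e}_{j_1\cdots j_t}\in\mathbb{N}^{n-2}$ is the exponent vector of the monomial $X_{j_1}\cdots X_{j_t}$ in $(X_3,\ldots,X_n)$ (indices may coincide), and in the unions above all index tuples $3\le j_1\le j_2\le\cdots\le n$ are taken. For finite sets $\mathcal{B}_1,\ldots,\mathcal{B}_N\subset\mathbb{Z}^N$,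 ${\rm MV}(\mathcal{B}_1,\ldots,\mathcal{B}_N)$ is the mixed volume of their convex hulls $P_1,\ldots,P_N$, i.e. the coefficient of $\lambda_1\cdots\lambda_N$ in ${\rm Vol}(\lambda_1P_1+\cdots+\lambda_NP_N)$, $\lambda_i\ge0$, with Minkowski sums. *)

theory Defs
  imports "HOL-Analysis.Analysis" "HOL-Library.Poly_Mapping" "HOL-Library.Extended_Nat"
begin

text \<open>
  The type \<open>'k\<close> is the index set \<open>{3,...,n}\<close>, so \<open>CARD('k) = n - 2\<close>. The index set
  \<open>{1,3,...,n}\<close> is \<open>'k option\<close>: \<open>None\<close> stands for 1 and \<open>Some s\<close> for
  \<open>s \<ge> 3\<close>. A point \<open>\<eta> :: real ^ 'k option\<close> has \<open>\<eta> $ None = R\<close> and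
  \<open>\<eta> $ Some s = X\<^sub>s\<close>.
\<close>

section \<open>The averaged functions\<close>

text \<open>
  \<open>p1 i1 i2 \<beta>\<close>, \<open>p2 i1 i2 \<beta>\<close> and \<open>ps s i1 i2 \<beta>\<close> are the coefficients of
  \<open>x\<^sub>1^i1 * x\<^sub>2^i2 * (\<Prod>s. x\<^sub>s^(\<beta> $ s))\<close> in the equations for \<open>x\<^sub>1\<close>, \<open>x\<^sub>2\<close> and
  \<open>x\<^sub>s\<close>; only those with \<open>i1 + i2 + (\<Sum>s. \<beta> $ s) = m\<close> are used. The parameter \<open>b\<^sub>1\<close> of
  the differential system does not occur in the first-order functions and is left out.
\<close>

record ('k::finite) params =
  par_a :: real
  par_b :: real
  par_c :: "'k \<Rightarrow> real"
  par_p1 :: "nat \<Rightarrow> nat \<Rightarrow> nat ^ 'k \<Rightarrow> real"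
  par_p2 :: "nat \<Rightarrow> nat \<Rightarrow> nat ^ 'k \<Rightarrow> real"
  par_ps :: "'k \<Rightarrow> nat \<Rightarrow> nat \<Rightarrow> nat ^ 'k \<Rightarrow> real"

definition multi_indices :: "nat \<Rightarrow> (nat \<times> nat \<times> (nat ^ 'k::finite)) set" where
  "multi_indices m = {(i1, i2, \<beta>). i1 + i2 + (\<Sum>s\<in>UNIV. \<beta> $ s) = m}"

definition polar_monom ::
    "nat \<Rightarrow> nat \<Rightarrow> nat ^ 'k \<Rightarrow> real \<Rightarrow> real ^ ('k::finite) option \<Rightarrow> real" where
  "polar_monom i1 i2 \<beta> \<theta> \<eta> =
     (\<eta> $ None * cos \<theta>) ^ i1 * (\<eta> $ None * sin \<theta>) ^ i2 * (\<Prod>s\<in>UNIV. (\<eta> $ Some s) ^ (\<beta> $ s))"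

fun F :: "('k::finite) params \<Rightarrow> nat \<Rightarrow> 'k option \<Rightarrow> real \<Rightarrow> real ^ 'k option \<Rightarrow> real" where
  "F q m None \<theta> \<eta> = 1 / par_b q *
     (par_a q * \<eta> $ None +
      (\<Sum>(i1, i2, \<beta>)\<in>multi_indices m.
         (par_p1 q i1 i2 \<beta> * cos \<theta> + par_p2 q i1 i2 \<beta> * sin \<theta>) * polar_monom i1 i2 \<beta> \<theta> \<eta>))"
| "F q m (Some s) \<theta> \<eta> = 1 / par_b q *
     (par_c q s * \<eta> $ Some s +
      (\<Sum>(i1, i2, \<beta>)\<in>multi_indices m. par_ps q s i1 i2 \<beta> * polar_monom i1 i2 \<beta> \<theta> \<eta>))"

definition f1 :: "('k::finite) params \<Rightarrow> nat \<Rightarrow> real ^ 'k option \<Rightarrow> real ^ 'k option" where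
  "f1 q m \<eta> = (\<chi> s. integral {0..2 * pi} (\<lambda>\<theta>. F q m s \<theta> \<eta>))"

definition simple_zeros :: "('k::finite) params \<Rightarrow> nat \<Rightarrow> (real ^ 'k option) set" where
  "simple_zeros q m =
     {\<eta>. \<eta> $ None > 0 \<and> f1 q m \<eta> = 0 \<and> det (jacobian (f1 q m) (at \<eta>)) \<noteq> 0}"

definition ecard :: "'a set \<Rightarrow> enat" where
  "ecard S = (if finite S then enat (card S) else \<infinity>)"

text \<open>
  The supremum is taken in \<open>enat\<close>, where a finite supremum of a nonempty set is attained; so
  once it is finite it is a maximum.
\<close>

definition H1 :: "('k::finite) itself \<Rightarrow> nat \<Rightarrow> enat" where
  "H1 _ m = Sup {ecard (simple_zeros q m) | q :: 'k params.
                   par_b q \<noteq> 0 \<and> (\<exists>\<eta>. \<eta> $ None > 0 \<and> f1 q m \<eta> \<noteq> 0)}"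

section \<open>Reduced polynomials and their generic supports\<close>

text \<open>
  A polynomial in variables indexed by \<open>'v\<close> is a finitely supported map from exponent vectors
  to coefficients.
\<close>

definition eval_poly :: "((nat ^ 'v::finite) \<Rightarrow>\<^sub>0 real) \<Rightarrow> real ^ 'v \<Rightarrow> real" where
  "eval_poly P x =
     (\<Sum>\<alpha>\<in>Poly_Mapping.keys P. Poly_Mapping.lookup P \<alpha> * (\<Prod>i\<in>UNIV. (x $ i) ^ (\<alpha> $ i)))"

definition to_rho :: "real ^ ('k::finite) option \<Rightarrow> real ^ 'k option" where
  "to_rho \<eta> = (\<chi> i. case i of None \<Rightarrow> (\<eta> $ None)\<^sup>2 | Some s \<Rightarrow> \<eta> $ Some s)"

definition fbar :: "('k::finite) params \<Rightarrow> nat \<Rightarrow> 'k option \<Rightarrow> ((nat ^ 'k option) \<Rightarrow>\<^sub>0 real)" where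
  "fbar q m s = (THE P. \<forall>\<eta>. \<eta> $ None > 0 \<longrightarrow>
     f1 q m \<eta> $ s =
       (case s of None \<Rightarrow> \<eta> $ None / par_b q | Some _ \<Rightarrow> 1 / par_b q) * eval_poly P (to_rho \<eta>))"

text \<open>
  Each coefficient of \<^term>\<open>fbar q m s\<close> is a linear form in the parameters. With the parameters
  as indeterminates, an exponent is in the support iff that form is not the zero form, i.e. (over
  the reals) iff it does not vanish for all parameter values.
\<close>

definition supp_gen :: "nat \<Rightarrow> ('k::finite) option \<Rightarrow> (nat ^ 'k option) set" where
  "supp_gen m s =
     {\<alpha>. \<exists>q :: 'k params. par_b q \<noteq> 0 \<and> Poly_Mapping.lookup (fbar q m s) \<alpha> \<noteq> 0}"

section \<open>Mixed volume\<close>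

definition hull_int :: "(int ^ 'v::finite) set \<Rightarrow> (real ^ 'v) set" where
  "hull_int B = convex hull ((\<lambda>\<alpha>. \<chi> i. real_of_int (\<alpha> $ i)) ` B)"

definition mink_comb :: "('v \<Rightarrow> (real ^ 'v::finite) set) \<Rightarrow> real ^ 'v \<Rightarrow> (real ^ 'v) set" where
  "mink_comb P l = {\<Sum>i\<in>UNIV. l $ i *\<^sub>R x i | x. \<forall>i. x i \<in> P i}"

definition volume_poly :: "('v \<Rightarrow> (real ^ 'v::finite) set) \<Rightarrow> ((nat ^ 'v) \<Rightarrow>\<^sub>0 real)" where
  "volume_poly P = (THE Q. \<forall>l. (\<forall>i. l $ i \<ge> 0) \<longrightarrow>
     measure lebesgue (mink_comb P l) = eval_poly Q l)"

text \<open>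
  The number of sets equals the dimension, so one index type serves for both. No factor
  \<open>1 / N!\<close> is included.
\<close>

definition MV :: "('v \<Rightarrow> (int ^ 'v::finite) set) \<Rightarrow> real" where
  "MV B = Poly_Mapping.lookup (volume_poly (\<lambda>i. hull_int (B i))) (\<chi> i. 1)"

definition int_exps :: "(nat ^ 'v::finite) set \<Rightarrow> (int ^ 'v) set" where
  "int_exps A = (\<lambda>\<alpha>. \<chi> i. int (\<alpha> $ i)) ` A"

section \<open>Exponent vectors\<close>

definition exp_pair :: "nat \<Rightarrow> nat ^ 'k \<Rightarrow> nat ^ ('k::finite) option" where
  "exp_pair a \<beta> = (\<chi> i. case i of None \<Rightarrow> a | Some s \<Rightarrow> \<beta> $ s)"

text \<open>
  The exponent vector of \<open>X\<^sub>j\<^sub>1 \<dots> X\<^sub>j\<^sub>t\<close> does not depend on the order of the indices, so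
  arbitrary index lists give the same vectors as the nondecreasing ones.
\<close>

definition e_vec :: "'k list \<Rightarrow> nat ^ ('k::finite)" where
  "e_vec js = (\<chi> s. count_list js s)"

end

theory Submission
  imports Defs
begin

text \<open>
  Both sides are compared with the weighted Bezout number \<open>(m - 1) m^k / 2\<close>, where \<open>k = n - 2\<close>.

  In the variables \<open>(R, X)\<close> the components of \<open>f\<^sub>1\<close>, the first one divided by \<open>R\<close>, are polynomials of
  degrees \<open>m - 1, m, ..., m\<close> that are even in \<open>R\<close>. Bezout's inequality for nondegenerate real zeros
  allows at most \<open>(m - 1) m^k\<close> of them, and they come in pairs \<open>(\<plusminus>R, X)\<close>.

  With the weight \<open>2 a + |b|\<close> of an exponent \<open>(a, b)\<close>, every support consists of a full weight level
  together with points of lower weight. The polytopes are therefore weighted simplices, with a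
  corner cut off if the weight is odd, and all cuts have the same direction.
  Minkowski sums stay within this family, whose volume is a difference of two powers of linear forms;
  the cut contributes a power of a form in which some variable is missing, so the mixed volume
  is the one of the uncut simplices.
\<close>

section \<open>Monomials and linear relations\<close>

text \<open>The common number takes the place of Bernstein's theorem. Its factor 1/2 is the
  reciprocal of the weight of \<rho>: for the zeros it comes from the symmetry in \<open>R\<close>,
  for the polytopes from the volume of a weighted simplex. On the polytope side the obstacle is
  integrality. A weighted simplex of size T has the vertex (T/2, 0), which is no lattice point if T
  is odd; exponents of odd weight have |b| >= 1, and the cut runs through the origin and the points
  ((T-1)/2, e_j). Exactly one of m - 1 and m is odd. Hence all odd sizes coincide, which makes the
  cuts parallel, and some polytope is uncut, which is why a variable is missing from the second
  form. On the side of the zeros, the given system may have infinitely many degenerate or complex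
  zeros, so its zeros are not counted algebraically. Small multiples of x_i^(d_i) are added instead:
  nondegenerate zeros survive, and for all but finitely many multiples the evaluations at them are
  independent already on the monomials that no x_i^(d_i) divides, of which there are d_1 ...
  d_N.\<close>

definition monom_at :: "nat ^ 'v \<Rightarrow> real ^ 'v::finite \<Rightarrow> real" where
  "monom_at \<alpha> x = (\<Prod>i\<in>UNIV. (x $ i) ^ (\<alpha> $ i))"

lemma monom_at_add: "monom_at (\<alpha> + \<beta>) x = monom_at \<alpha> x * monom_at \<beta> x"
  by (simp add: monom_at_def power_add prod.distrib)

lemma monom_at_zero [simp]: "monom_at 0 x = 1"
  by (simp add: monom_at_def)

lemma monom_at_axis [simp]: "monom_at (axis i k) x = (x $ i) ^ k"
proof -
  have "monom_at (axis i k) x = (\<Prod>j\<in>UNIV. if j = i then (x $ i) ^ k else 1)"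
    unfolding monom_at_def by (intro prod.cong) (auto simp: axis_def)
  then show ?thesis by simp
qed

lemma monom_at_mult:
  "monom_at \<alpha> (\<chi> i. x $ i * y $ i) = monom_at \<alpha> x * monom_at \<alpha> y"
  by (simp add: monom_at_def power_mult_distrib prod.distrib)

lemma monom_at_neq:
  assumes "\<alpha> \<noteq> \<beta>"
  obtains y :: "real ^ 'v::finite" where "\<And>i. y $ i > 0" "monom_at \<alpha> y \<noteq> monom_at \<beta> y"
proof -
  obtain i where i: "\<alpha> $ i \<noteq> \<beta> $ i" using assms by (auto simp: vec_eq_iff)
  define y :: "real ^ 'v" where "y = (\<chi> j. if j = i then 2 else 1)"
  have "monom_at \<gamma> y = 2 ^ (\<gamma> $ i)" for \<gamma>
  proof -
    have "monom_at \<gamma> y = (\<Prod>j\<in>UNIV. if j = i then 2 ^ (\<gamma> $ i) else 1)"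
      unfolding monom_at_def by (intro prod.cong) (auto simp: y_def)
    then show ?thesis by simp
  qed
  with i have "monom_at \<alpha> y \<noteq> monom_at \<beta> y" by simp
  moreover have "y $ j > 0" for j by (simp add: y_def)
  ultimately show thesis using that by blast
qed

text \<open>Monomials are multiplicative characters of the positive orthant, and distinct characters
  are linearly independent (Artin's argument).\<close>

lemma monom_at_independent:
  assumes "finite S"
    and "\<And>x :: real ^ 'v::finite. (\<And>i. x $ i > 0) \<Longrightarrow> (\<Sum>\<alpha>\<in>S. c \<alpha> * monom_at \<alpha> x) = 0"
  shows "\<forall>\<alpha>\<in>S. c \<alpha> = 0"
  using assms
proof (induction S arbitrary: c rule: finite_induct)
  case empty
  then show ?case by simp
next
  case (insert \<beta> S)
  have rest: "c \<alpha> = 0" if "\<alpha> \<in> S" for \<alpha>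
  proof -
    from that insert.hyps have "\<alpha> \<noteq> \<beta>" by auto
    then obtain y where y: "\<And>i. y $ i > 0" "monom_at \<alpha> y \<noteq> monom_at \<beta> y"
      using monom_at_neq by blast
    define c' where "c' = (\<lambda>\<alpha>. c \<alpha> * (monom_at \<alpha> y - monom_at \<beta> y))"
    have "(\<Sum>\<alpha>\<in>S. c' \<alpha> * monom_at \<alpha> x) = 0" if x: "\<And>i. x $ i > 0" for x
    proof -
      have "(\<Sum>\<alpha>\<in>insert \<beta> S. c \<alpha> * monom_at \<alpha> (\<chi> i. x $ i * y $ i)) = 0"
        by (rule insert.prems) (use x y in auto)
      moreover have "(\<Sum>\<alpha>\<in>insert \<beta> S. c \<alpha> * monom_at \<alpha> x) = 0"
        by (rule insert.prems) (use x in auto)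
      ultimately have "(\<Sum>\<alpha>\<in>insert \<beta> S. c \<alpha> * monom_at \<alpha> (\<chi> i. x $ i * y $ i))
          - monom_at \<beta> y * (\<Sum>\<alpha>\<in>insert \<beta> S. c \<alpha> * monom_at \<alpha> x) = 0" by simp
      moreover have "(\<Sum>\<alpha>\<in>insert \<beta> S. c \<alpha> * monom_at \<alpha> (\<chi> i. x $ i * y $ i))
          - monom_at \<beta> y * (\<Sum>\<alpha>\<in>insert \<beta> S. c \<alpha> * monom_at \<alpha> x)
          = (\<Sum>\<alpha>\<in>insert \<beta> S. c' \<alpha> * monom_at \<alpha> x)"
        unfolding sum_distrib_left sum_subtractf[symmetric] monom_at_mult c'_def
        by (intro sum.cong) (auto simp: algebra_simps)
      moreover have "c' \<beta> = 0" by (simp add: c'_def)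
      ultimately show ?thesis using insert.hyps by simp
    qed
    then have "c' \<alpha> = 0" using insert.IH[of c'] \<open>\<alpha> \<in> S\<close> by blast
    with y show ?thesis by (simp add: c'_def)
  qed
  have "(\<Sum>\<alpha>\<in>insert \<beta> S. c \<alpha> * monom_at \<alpha> (1 :: real ^ 'v)) = 0"
    by (rule insert.prems) auto
  then have "c \<beta> = 0"
    using insert.hyps rest by (simp add: monom_at_def)
  with rest show ?case by simp
qed

section \<open>Polynomials and their values\<close>

lemma eval_poly_superset:
  assumes "finite S" "Poly_Mapping.keys P \<subseteq> S"
  shows "eval_poly P x = (\<Sum>\<alpha>\<in>S. Poly_Mapping.lookup P \<alpha> * monom_at \<alpha> x)"
  unfolding eval_poly_def monom_at_def[symmetric]
  by (rule sum.mono_neutral_left) (use assms in \<open>auto simp: in_keys_iff\<close>)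

lemma eval_poly_add: "eval_poly (P + Q) x = eval_poly P x + eval_poly Q x"
proof -
  let ?S = "Poly_Mapping.keys P \<union> Poly_Mapping.keys Q"
  have "finite ?S" "Poly_Mapping.keys (P + Q) \<subseteq> ?S" using keys_add[of P Q] by auto
  then show ?thesis
    by (simp add: eval_poly_superset[of ?S] lookup_add distrib_right sum.distrib)
qed

lemma eval_poly_zero [simp]: "eval_poly 0 x = 0"
  by (simp add: eval_poly_def)

lemma eval_poly_single [simp]: "eval_poly (Poly_Mapping.single \<alpha> c) x = c * monom_at \<alpha> x"
  by (cases "c = 0") (simp_all add: eval_poly_def monom_at_def)

lemma eval_poly_sum: "eval_poly (sum P A) x = (\<Sum>a\<in>A. eval_poly (P a) x)"
  by (induction A rule: infinite_finite_induct) (simp_all add: eval_poly_add)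

text \<open>\<open>fbar\<close> and \<open>volume_poly\<close> are specified by values at arguments
  that include the positive orthant, so uniqueness is derived from positive arguments alone.\<close>

lemma eval_poly_unique:
  fixes P Q :: "(nat ^ 'v::finite) \<Rightarrow>\<^sub>0 real"
  assumes "\<And>x. (\<And>i. x $ i > 0) \<Longrightarrow> eval_poly P x = eval_poly Q x"
  shows "P = Q"
proof (rule poly_mapping_eqI)
  fix \<alpha>
  let ?S = "Poly_Mapping.keys P \<union> Poly_Mapping.keys Q"
  let ?c = "\<lambda>\<alpha>. Poly_Mapping.lookup P \<alpha> - Poly_Mapping.lookup Q \<alpha>"
  have "\<forall>\<alpha>\<in>?S. ?c \<alpha> = 0"
  proof (rule monom_at_independent)
    fix x :: "real ^ 'v" assume "\<And>i. x $ i > 0"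
    from assms[OF this] show "(\<Sum>\<alpha>\<in>?S. ?c \<alpha> * monom_at \<alpha> x) = 0"
      by (simp add: eval_poly_superset[of ?S] left_diff_distrib sum_subtractf)
  qed simp
  then have "?c \<alpha> = 0" if "\<alpha> \<in> ?S" using that by blast
  moreover have "?c \<alpha> = 0" if "\<alpha> \<notin> ?S" using that by (simp add: in_keys_iff)
  ultimately show "Poly_Mapping.lookup P \<alpha> = Poly_Mapping.lookup Q \<alpha>" by fastforce
qed

section \<open>Linear relations and eigenvalues\<close>

lemma ex_nontrivial_relation:
  fixes w :: "'j \<Rightarrow> 's \<Rightarrow> real"
  assumes "finite S" "finite J" "card S < card J"
  shows "\<exists>c. (\<exists>j\<in>J. c j \<noteq> 0) \<and> (\<forall>s\<in>S. (\<Sum>j\<in>J. c j * w j s) = 0)"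
  using assms
proof (induction S arbitrary: w J rule: finite_induct)
  case empty
  then have "J \<noteq> {}" by auto
  then show ?case by (intro exI[of _ "\<lambda>_. 1"]) auto
next
  case (insert s S)
  show ?case
  proof (cases "\<forall>j\<in>J. w j s = 0")
    case True
    moreover have "card S < card J" using insert by simp
    then obtain c where "\<exists>j\<in>J. c j \<noteq> 0" "\<forall>s\<in>S. (\<Sum>j\<in>J. c j * w j s) = 0"
      using insert.IH[of J w] insert.prems by blast
    ultimately show ?thesis by (intro exI[of _ c]) auto
  next
    case False
    then obtain k where k: "k \<in> J" "w k s \<noteq> 0" by blast
    let ?J = "J - {k}"
    have "card S < card ?J" using insert k by simp
    then obtain c where c: "\<exists>j\<in>?J. c j \<noteq> 0"
        "\<forall>t\<in>S. (\<Sum>j\<in>?J. c j * (w j t - w j s / w k s * w k t)) = 0"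
      using insert.IH[of ?J "\<lambda>j t. w j t - w j s / w k s * w k t"] insert.prems by blast
    \<comment> \<open>The coefficient of the pivot vector \<open>w k\<close> that makes coordinate s
      vanish; in the other coordinates it accounts for the eliminated multiples of
      \<open>w k\<close>.\<close>
    define a where "a = - (\<Sum>j\<in>?J. c j * w j s) / w k s"
    define c' where "c' = c(k := a)"
    have sum: "(\<Sum>j\<in>J. c' j * w j t) = a * w k t + (\<Sum>j\<in>?J. c j * w j t)" for t
    proof -
      have "(\<Sum>j\<in>J. c' j * w j t) = c' k * w k t + (\<Sum>j\<in>?J. c' j * w j t)"
        using k insert.prems by (intro sum.remove) auto
      moreover have "(\<Sum>j\<in>?J. c' j * w j t) = (\<Sum>j\<in>?J. c j * w j t)"
        by (intro sum.cong) (auto simp: c'_def)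
      ultimately show ?thesis by (simp add: c'_def)
    qed
    have "a * w k t + (\<Sum>j\<in>?J. c j * w j t)
        = (\<Sum>j\<in>?J. c j * (w j t - w j s / w k s * w k t))" for t
      by (simp add: a_def sum_distrib_right right_diff_distrib sum_subtractf sum_divide_distrib
          sum_distrib_left sum_negf mult_ac)
    with c sum have "\<forall>t\<in>S. (\<Sum>j\<in>J. c' j * w j t) = 0" by simp
    moreover have "(\<Sum>j\<in>J. c' j * w j s) = 0"
      unfolding sum using k by (simp add: a_def)
    moreover have "\<exists>j\<in>J. c' j \<noteq> 0" using c by (auto simp: c'_def)
    ultimately show ?thesis by (intro exI[of _ c']) auto
  qed
qed

text \<open>Applying A - k to a relation deletes the eigenvector for k and multiplies the others by
  l - k, which is nonzero. Matrices are plain functions on an index set because their size will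
  depend on the number of zeros.\<close>

lemma eigenvectors_independent:
  fixes A :: "'s \<Rightarrow> 's \<Rightarrow> real"
  assumes "finite L"
    and "\<And>l. l \<in> L \<Longrightarrow> \<exists>s\<in>S. v l s \<noteq> 0"
    and "\<And>l s. l \<in> L \<Longrightarrow> s \<in> S \<Longrightarrow> (\<Sum>t\<in>S. A s t * v l t) = l * v l s"
    and "\<And>s. s \<in> S \<Longrightarrow> (\<Sum>l\<in>L. c l * v l s) = 0"
  shows "\<forall>l\<in>L. c l = 0"
  using assms
proof (induction L arbitrary: c rule: finite_induct)
  case empty
  then show ?case by simp
next
  case (insert k L)
  have "\<forall>l\<in>L. c l * (l - k) = 0"
  proof (rule insert.IH)
    fix s assume s: "s \<in> S"
    have "0 = (\<Sum>t\<in>S. A s t * (\<Sum>l\<in>insert k L. c l * v l t))"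
      using insert.prems(3) by simp
    also have "\<dots> = (\<Sum>l\<in>insert k L. c l * (\<Sum>t\<in>S. A s t * v l t))"
      unfolding sum_distrib_left by (subst sum.swap) (simp add: algebra_simps)
    also have "\<dots> = (\<Sum>l\<in>insert k L. c l * (l * v l s))"
      using insert.prems(2) s by (intro sum.cong) auto
    finally have "(\<Sum>l\<in>insert k L. c l * (l * v l s)) - k * (\<Sum>l\<in>insert k L. c l * v l s) = 0"
      using insert.prems(3)[OF s] by simp
    then have "(\<Sum>l\<in>insert k L. c l * (l - k) * v l s) = 0"
      unfolding sum_distrib_left sum_subtractf[symmetric] by (simp add: algebra_simps)
    then show "(\<Sum>l\<in>L. c l * (l - k) * v l s) = 0" using insert.hyps by simp
  qed (use insert.prems in auto)
  then have rest: "\<forall>l\<in>L. c l = 0" using insert.hyps by auto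
  obtain s where s: "s \<in> S" "v k s \<noteq> 0" using insert.prems(1) by blast
  have "(\<Sum>l\<in>insert k L. c l * v l s) = 0" by (rule insert.prems(3)) fact
  with s rest insert.hyps have "c k = 0" by simp
  with rest show ?case by simp
qed

text \<open>More than \<open>card S\<close> eigenvectors in a space of dimension
  \<open>card S\<close> would satisfy a relation, against their independence. This replaces the
  characteristic polynomial.\<close>

lemma finite_eigenvalues:
  fixes A :: "'s \<Rightarrow> 's \<Rightarrow> real"
  assumes S: "finite S"
  shows "finite {l. \<exists>v. (\<exists>s\<in>S. v s \<noteq> 0) \<and> (\<forall>s\<in>S. (\<Sum>t\<in>S. A s t * v t) = l * v s)}"
    (is "finite ?E")
proof (rule ccontr)
  assume "infinite ?E"
  then obtain L where L: "finite L" "card L = Suc (card S)" "L \<subseteq> ?E"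
    using infinite_arbitrarily_large by blast
  have "\<exists>v. (\<exists>s\<in>S. v s \<noteq> 0) \<and> (\<forall>s\<in>S. (\<Sum>t\<in>S. A s t * v t) = l * v s)" if "l \<in> L" for l
    using subsetD[OF L(3) that] by simp
  then obtain v where v: "\<And>l. l \<in> L \<Longrightarrow> (\<exists>s\<in>S. v l s \<noteq> 0) \<and> (\<forall>s\<in>S. (\<Sum>t\<in>S. A s t * v l t) = l * v l s)"
    by metis
  have "card S < card L" using L by simp
  from ex_nontrivial_relation[OF S L(1) this, of v]
  obtain c where c: "(\<exists>l\<in>L. c l \<noteq> 0) \<and> (\<forall>s\<in>S. (\<Sum>l\<in>L. c l * v l s) = 0)" ..
  have "\<forall>l\<in>L. c l = 0"
  proof (rule eigenvectors_independent)
    show "finite L" by (fact L(1))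
    show "\<exists>s\<in>S. v l s \<noteq> 0" if "l \<in> L" for l using v[OF that] ..
    show "(\<Sum>t\<in>S. A s t * v l t) = l * v l s" if "l \<in> L" "s \<in> S" for l s
      using v[OF that(1)] that(2) by blast
    show "(\<Sum>l\<in>L. c l * v l s) = 0" if "s \<in> S" for s using c that by blast
  qed
  with c show False by blast
qed

section \<open>Bezout's inequality for nondegenerate zeros\<close>

lemma finite_bounded_exponents: "finite {\<alpha> :: nat ^ 'v::finite. (\<Sum>i\<in>UNIV. \<alpha> $ i) \<le> D}"
proof -
  have "vec_nth ` {\<alpha> :: nat ^ 'v. (\<Sum>i\<in>UNIV. \<alpha> $ i) \<le> D} \<subseteq> (\<Pi>\<^sub>E i\<in>UNIV. {..D})"
  proof (clarsimp simp: PiE_UNIV_domain)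
    fix \<alpha> :: "nat ^ 'v" and i assume "(\<Sum>i\<in>UNIV. \<alpha> $ i) \<le> D"
    moreover have "\<alpha> $ i \<le> (\<Sum>i\<in>UNIV. \<alpha> $ i)" by (rule member_le_sum) auto
    ultimately show "\<alpha> $ i \<le> D" by linarith
  qed
  then have "finite (vec_nth ` {\<alpha> :: nat ^ 'v. (\<Sum>i\<in>UNIV. \<alpha> $ i) \<le> D})"
    by (rule finite_subset) (auto intro: finite_PiE)
  then show ?thesis by (rule finite_imageD) (auto simp: inj_on_def vec_nth_inject)
qed

text \<open>These are the exponents of the monomials that no x_i^(d_i) divides; the Bezout number
  enters the proof as their number.\<close>

lemma card_exponents_below: "card {\<alpha> :: nat ^ 'v::finite. \<forall>i. \<alpha> $ i < d i} = (\<Prod>i\<in>UNIV. d i)"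
proof -
  have "bij_betw vec_nth {\<alpha> :: nat ^ 'v. \<forall>i. \<alpha> $ i < d i} (\<Pi>\<^sub>E i\<in>UNIV. {..<d i})"
    by (rule bij_betw_byWitness[of _ vec_lambda]) (auto simp: PiE_UNIV_domain)
  then have "card {\<alpha> :: nat ^ 'v. \<forall>i. \<alpha> $ i < d i} = card (\<Pi>\<^sub>E i\<in>(UNIV :: 'v set). {..<d i})"
    by (rule bij_betw_same_card)
  then show ?thesis by (simp add: card_PiE)
qed

section \<open>Persistence of nondegenerate zeros\<close>

lemma continuous_on_monom_at: "continuous_on S (monom_at \<alpha>)"
  unfolding monom_at_def[abs_def] by (intro continuous_intros)

lemma has_derivative_vecI:
  fixes f :: "'a::real_normed_vector \<Rightarrow> real ^ 'v::finite"
  assumes "\<And>i. ((\<lambda>x. f x $ i) has_derivative (\<lambda>u. f' u $ i)) (at x within S)"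
  shows "(f has_derivative f') (at x within S)"
  unfolding has_derivative_componentwise_within[of f f']
  using assms by (auto simp: Basis_vec_def inner_axis)

lemma differentiable_vecI:
  fixes f :: "'a::real_normed_vector \<Rightarrow> real ^ 'v::finite"
  assumes "\<And>i. (\<lambda>x. f x $ i) differentiable (at x)"
  shows "f differentiable (at x)"
proof -
  from assms obtain D where "((\<lambda>x. f x $ i) has_derivative D i) (at x)" for i
    unfolding differentiable_def by metis
  then have "(f has_derivative (\<lambda>u. \<chi> i. D i u)) (at x)" by (intro has_derivative_vecI) simp
  then show ?thesis unfolding differentiable_def by blast
qed

lemma differentiable_vec_nth: "(\<lambda>x. x $ i) differentiable (at (x :: real ^ 'v::finite))"
  by (rule bounded_linear_imp_differentiable) (rule bounded_linear_vec_nth)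

text \<open>Sussmann's open mapping theorem for \<open>(x, \<epsilon>) \<mapsto> (g x + \<epsilon> h x, \<epsilon>)\<close> replaces an implicit
  function theorem.\<close>

lemma zero_persists:
  fixes g h :: "real ^ 'v::finite \<Rightarrow> real ^ 'v"
  assumes cont: "continuous_on UNIV g" "continuous_on UNIV h"
    and dg: "(g has_derivative g') (at z)" and dh: "(h has_derivative h') (at z)"
    and inj: "inj g'" and z: "g z = 0" and r: "r > 0"
  obtains \<delta> where "\<delta> > 0" "\<And>\<epsilon>. \<bar>\<epsilon>\<bar> < \<delta> \<Longrightarrow> \<exists>x. dist z x < r \<and> g x + \<epsilon> *\<^sub>R h x = 0"
proof -
  define \<Psi> where "\<Psi> = (\<lambda>p :: (real ^ 'v) \<times> real. (g (fst p) + snd p *\<^sub>R h (fst p), snd p))"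
  define \<Psi>' where "\<Psi>' = (\<lambda>p :: (real ^ 'v) \<times> real. (g' (fst p) + snd p *\<^sub>R h z, snd p))"
  have g': "linear g'" using dg by (rule has_derivative_linear)
  then obtain k where k: "linear k" "k \<circ> g' = id" "g' \<circ> k = id"
    using inj linear_injective_isomorphism by (metis eq_id_iff comp_def)
  \<comment> \<open>\<open>\<Psi>'\<close> is block triangular with diagonal blocks
    \<open>g'\<close> and 1, so back substitution inverts it.\<close>
  define \<Phi> where "\<Phi> = (\<lambda>p :: (real ^ 'v) \<times> real. (k (fst p - snd p *\<^sub>R h z), snd p))"
  have "(\<Psi> has_derivative \<Psi>') (at (z, 0))"
  proof -
    have "((\<lambda>p. g (fst p)) has_derivative (\<lambda>p. g' (fst p))) (at (z, 0 :: real))"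
      by (rule has_derivative_compose[of fst fst _ _ g g'])
        (use dg in \<open>auto intro: has_derivative_fst has_derivative_ident\<close>)
    moreover have "((\<lambda>p. h (fst p)) has_derivative (\<lambda>p. h' (fst p))) (at (z, 0 :: real))"
      by (rule has_derivative_compose[of fst fst _ _ h h'])
        (use dh in \<open>auto intro: has_derivative_fst has_derivative_ident\<close>)
    ultimately show ?thesis
      unfolding \<Psi>_def \<Psi>'_def by (auto intro!: derivative_eq_intros)
  qed
  moreover have "continuous_on UNIV \<Psi>"
    unfolding \<Psi>_def
    by (intro continuous_intros continuous_on_compose2[OF cont(1)] continuous_on_compose2[OF cont(2)])
      auto
  moreover have "linear \<Phi>"
    using k(1) unfolding \<Phi>_def
    by (intro linearI) (auto simp: linear_add linear_diff linear_scale algebra_simps)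
  moreover have "\<Psi>' \<circ> \<Phi> = id"
    using k(3) by (auto simp: \<Psi>'_def \<Phi>_def fun_eq_iff)
  moreover have "(z, 0) \<in> interior (ball z r \<times> UNIV)"
    using r by (simp add: interior_Times)
  ultimately have "\<Psi> (z, 0) \<in> interior (\<Psi> ` (ball z r \<times> UNIV))"
    using sussmann_open_mapping[of UNIV \<Psi> "(z, 0)" \<Psi>' \<Phi> "ball z r \<times> UNIV"]
    by (simp add: linear_linear)
  then obtain \<delta> where \<delta>: "\<delta> > 0" "ball (\<Psi> (z, 0)) \<delta> \<subseteq> \<Psi> ` (ball z r \<times> UNIV)"
    unfolding mem_interior by blast
  have "\<exists>x. dist z x < r \<and> g x + \<epsilon> *\<^sub>R h x = 0" if "\<bar>\<epsilon>\<bar> < \<delta>" for \<epsilon>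
  proof -
    have "\<Psi> (z, 0) = (0, 0)" using z by (simp add: \<Psi>_def)
    then have "(0, \<epsilon>) \<in> ball (\<Psi> (z, 0)) \<delta>" using that by (simp add: dist_Pair_Pair)
    with \<delta> have "(0, \<epsilon>) \<in> \<Psi> ` (ball z r \<times> UNIV)" by blast
    then show ?thesis by (auto simp: \<Psi>_def)
  qed
  with \<delta>(1) show thesis using that by blast
qed

text \<open>Each perturbed zero is sought within half the least distance between two points of Z,
  which keeps different ones apart; a common \<delta> exists because Z is finite.\<close>

lemma zeros_persist:
  fixes g h :: "real ^ 'v::finite \<Rightarrow> real ^ 'v"
  assumes cont: "continuous_on UNIV g" "continuous_on UNIV h"
    and Z: "finite Z" "\<And>z. z \<in> Z \<Longrightarrow> g z = 0"
    and dg: "\<And>z. z \<in> Z \<Longrightarrow> \<exists>g'. (g has_derivative g') (at z) \<and> inj g'"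
    and dh: "\<And>z. z \<in> Z \<Longrightarrow> h differentiable (at z)"
  obtains \<delta> where "\<delta> > 0"
    "\<And>\<epsilon>. \<bar>\<epsilon>\<bar> < \<delta> \<Longrightarrow> \<exists>y. inj_on y Z \<and> (\<forall>z\<in>Z. g (y z) + \<epsilon> *\<^sub>R h (y z) = 0)"
proof -
  obtain r where r: "r > 0" "\<And>a b. a \<in> Z \<Longrightarrow> b \<in> Z \<Longrightarrow> a \<noteq> b \<Longrightarrow> r \<le> dist a b"
  proof
    \<comment> \<open>The extra 1 keeps the minimum defined when Z has fewer than two
      points.\<close>
    let ?D = "insert 1 ((\<lambda>(a, b). dist a b) ` {p \<in> Z \<times> Z. fst p \<noteq> snd p})"
    have D: "finite ?D" using Z(1) by simp
    then show "Min ?D > 0" by (subst Min_gr_iff) auto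
    show "Min ?D \<le> dist a b" if "a \<in> Z" "b \<in> Z" "a \<noteq> b" for a b
      using D by (rule Min_le) (use that in force)
  qed
  have "\<exists>\<delta>>0. \<forall>\<epsilon>. \<bar>\<epsilon>\<bar> < \<delta> \<longrightarrow> (\<exists>x. dist z x < r / 2 \<and> g x + \<epsilon> *\<^sub>R h x = 0)" if z: "z \<in> Z" for z
  proof -
    obtain g' where "(g has_derivative g') (at z)" "inj g'" using dg[OF z] by blast
    moreover obtain h' where "(h has_derivative h') (at z)"
      using dh[OF z] unfolding differentiable_def by blast
    ultimately show ?thesis
      using zero_persists[OF cont, of g' z h' "r / 2"] Z(2)[OF z] r(1) by (metis half_gt_zero)
  qed
  then obtain \<delta> where \<delta>: "\<And>z. z \<in> Z \<Longrightarrow> \<delta> z > (0 :: real)"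
    "\<And>z \<epsilon>. z \<in> Z \<Longrightarrow> \<bar>\<epsilon>\<bar> < \<delta> z \<Longrightarrow> \<exists>x. dist z x < r / 2 \<and> g x + \<epsilon> *\<^sub>R h x = 0"
    by metis
  define \<delta>0 where "\<delta>0 = Min (insert 1 (\<delta> ` Z))"
  have "\<delta>0 > 0" unfolding \<delta>0_def using Z(1) \<delta>(1) by (subst Min_gr_iff) auto
  moreover have "\<exists>y. inj_on y Z \<and> (\<forall>z\<in>Z. g (y z) + \<epsilon> *\<^sub>R h (y z) = 0)" if \<epsilon>: "\<bar>\<epsilon>\<bar> < \<delta>0" for \<epsilon>
  proof -
    have "\<exists>x. dist z x < r / 2 \<and> g x + \<epsilon> *\<^sub>R h x = 0" if z: "z \<in> Z" for z
    proof (rule \<delta>(2)[OF z])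
      have "\<delta>0 \<le> \<delta> z" unfolding \<delta>0_def using Z(1) z by (intro Min_le) auto
      with \<epsilon> show "\<bar>\<epsilon>\<bar> < \<delta> z" by simp
    qed
    then obtain y where y: "\<And>z. z \<in> Z \<Longrightarrow> dist z (y z) < r / 2 \<and> g (y z) + \<epsilon> *\<^sub>R h (y z) = 0"
      by metis
    have "inj_on y Z"
    proof (rule inj_onI, rule ccontr)
      fix a b assume ab: "a \<in> Z" "b \<in> Z" "y a = y b" "a \<noteq> b"
      have "dist a b \<le> dist a (y a) + dist b (y b)"
        using dist_triangle2[of a b "y a"] ab(3) by simp
      also have "\<dots> < r" using y[OF ab(1)] y[OF ab(2)] by simp
      finally show False using r(2)[OF ab(1,2,4)] by simp
    qed
    with y show ?thesis by blast
  qed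
  ultimately show thesis using that by blast
qed

text \<open>Lagrange interpolation: multiplying by the linear factors that vanish at the other points.\<close>

lemma monomials_separate_points:
  fixes y :: "'j \<Rightarrow> real ^ 'v::finite"
  assumes J: "finite J" "inj_on y J"
    and vanish: "\<And>\<gamma>. (\<Sum>i\<in>UNIV. \<gamma> $ i) \<le> card J \<Longrightarrow> (\<Sum>j\<in>J. c j * monom_at \<gamma> (y j)) = 0"
  shows "\<forall>j\<in>J. c j = 0"
proof
  fix k assume k: "k \<in> J"
  have "\<exists>i. y k $ i \<noteq> y t $ i" if "t \<in> J - {k}" for t
    using J(2) k that by (metis DiffD1 DiffD2 inj_on_eq_iff singletonI vec_eq_iff)
  then obtain n where n: "\<And>t. t \<in> J - {k} \<Longrightarrow> y k $ n t \<noteq> y t $ n t" by metis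
  \<comment> \<open>Factors are traded against degree: expanding one factor gives two sums with one
    factor less, one of them with the exponent raised by 1. At T = {} only monomial relations
    remain.\<close>
  have step: "(\<Sum>j\<in>J. c j * monom_at \<gamma> (y j) * (\<Prod>t\<in>T. y j $ n t - y t $ n t)) = 0"
    if "finite T" "(\<Sum>i\<in>UNIV. \<gamma> $ i) + card T \<le> card J" for T \<gamma>
    using that
  proof (induction T arbitrary: \<gamma> rule: finite_induct)
    case empty
    then show ?case using vanish by simp
  next
    case (insert t T)
    let ?P = "\<lambda>j. \<Prod>t\<in>T. y j $ n t - y t $ n t"
    have "(\<Sum>i\<in>UNIV. (\<gamma> + axis (n t) 1) $ i) = (\<Sum>i\<in>UNIV. \<gamma> $ i) + 1"
      by (simp add: sum.distrib axis_def)
    then have "(\<Sum>j\<in>J. c j * monom_at (\<gamma> + axis (n t) 1) (y j) * ?P j) = 0"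
      using insert.IH[of "\<gamma> + axis (n t) 1"] insert.prems insert.hyps by simp
    moreover have "(\<Sum>j\<in>J. c j * monom_at \<gamma> (y j) * ?P j) = 0"
      using insert.IH[of \<gamma>] insert.prems insert.hyps by simp
    ultimately have "(\<Sum>j\<in>J. c j * monom_at (\<gamma> + axis (n t) 1) (y j) * ?P j)
        - y t $ n t * (\<Sum>j\<in>J. c j * monom_at \<gamma> (y j) * ?P j) = 0" by simp
    then show ?case
      unfolding sum_distrib_left sum_subtractf[symmetric]
      using insert.hyps by (simp add: monom_at_add algebra_simps)
  qed
  let ?T = "J - {k}"
  have "0 = (\<Sum>j\<in>J. c j * monom_at 0 (y j) * (\<Prod>t\<in>?T. y j $ n t - y t $ n t))"
    using step[of ?T 0] J(1) by (simp add: card_Diff_subset_Int card_Diff1_le)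
  also have "\<dots> = c k * (\<Prod>t\<in>?T. y k $ n t - y t $ n t)
      + (\<Sum>j\<in>?T. c j * (\<Prod>t\<in>?T. y j $ n t - y t $ n t))"
    using J(1) k by (simp add: sum.remove[of J k])
  \<comment> \<open>Every j other than k meets its own factor, which is 0.\<close>
  also have "(\<Sum>j\<in>?T. c j * (\<Prod>t\<in>?T. y j $ n t - y t $ n t)) = 0"
  proof (rule sum.neutral, rule ballI)
    fix j assume "j \<in> ?T"
    then have "(\<Prod>t\<in>?T. y j $ n t - y t $ n t) = 0"
      using J(1) by (intro prod_zero) auto
    then show "c j * (\<Prod>t\<in>?T. y j $ n t - y t $ n t) = 0" by simp
  qed
  finally show "c k = 0" using n J(1) by (auto simp: prod_zero_iff)
qed

text \<open>After adding \<open>\<epsilon> x\<^sub>i^d\<^sub>i\<close> to the \<open>i\<close>-th polynomial, a linear relation between the values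
  of all monomials with exponents below \<open>d\<close> at the zeros yields an eigenvector, for the eigenvalue
  \<open>- \<epsilon>\<close>, of a matrix that does not depend on \<open>\<epsilon>\<close>. A matrix has only finitely many
  eigenvalues, whereas nondegenerate zeros persist for all small \<open>\<epsilon>\<close>.\<close>

theorem bezout_nondegenerate_zeros:
  fixes g :: "real ^ 'v::finite \<Rightarrow> real ^ 'v" and e :: "'a \<Rightarrow> nat ^ 'v"
  assumes I: "\<And>i. finite (I i)"
    and g: "\<And>x i. g x $ i = (\<Sum>a\<in>I i. c i a * monom_at (e a) x)"
    and deg: "\<And>i a. a \<in> I i \<Longrightarrow> (\<Sum>j\<in>UNIV. e a $ j) \<le> d i"
    and Z: "finite Z" "\<And>z. z \<in> Z \<Longrightarrow> g z = 0"
    and nondeg: "\<And>z. z \<in> Z \<Longrightarrow> \<exists>g'. (g has_derivative g') (at z) \<and> inj g'"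
  shows "card Z \<le> (\<Prod>i\<in>UNIV. d i)"
proof (rule ccontr)
  assume "\<not> card Z \<le> (\<Prod>i\<in>UNIV. d i)"
  then have card_Z: "(\<Prod>i\<in>UNIV. d i) < card Z" by simp
  define h :: "real ^ 'v \<Rightarrow> real ^ 'v" where "h x = (\<chi> i. (x $ i) ^ d i)" for x
  have "g = (\<lambda>x. \<chi> i. \<Sum>a\<in>I i. c i a * monom_at (e a) x)"
    using g by (simp add: fun_eq_iff vec_eq_iff)
  then have "continuous_on UNIV g"
    by (auto intro!: continuous_intros continuous_on_monom_at)
  moreover have "continuous_on UNIV h"
    unfolding h_def by (intro continuous_intros)
  moreover have "h differentiable (at x)" for x
    unfolding h_def by (rule differentiable_vecI) (simp add: differentiable_vec_nth)
  ultimately obtain \<delta> where \<delta>: "\<delta> > 0"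
    "\<And>\<epsilon>. \<bar>\<epsilon>\<bar> < \<delta> \<Longrightarrow> \<exists>y. inj_on y Z \<and> (\<forall>z\<in>Z. g (y z) + \<epsilon> *\<^sub>R h (y z) = 0)"
    using zeros_persist[of g h Z] Z nondeg by blast
  \<comment> \<open>S will index the matrix. The bound \<open>card Z\<close> is the degree up to
    which \<open>monomials_separate_points\<close> uses monomials.\<close>
  define S where "S = {\<alpha> :: nat ^ 'v. (\<Sum>i\<in>UNIV. \<alpha> $ i) \<le> card Z}"
  have S: "finite S" unfolding S_def by (rule finite_bounded_exponents)
  define std where "std = {\<alpha> :: nat ^ 'v. \<forall>i. \<alpha> $ i < d i}"
  have card_std: "card std = (\<Prod>i\<in>UNIV. d i)"
    unfolding std_def by (rule card_exponents_below)
  have std: "finite std"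
  proof (rule finite_subset)
    show "std \<subseteq> {\<alpha>. (\<Sum>i\<in>UNIV. \<alpha> $ i) \<le> (\<Sum>i\<in>UNIV. d i)}"
      by (auto simp: std_def less_imp_le intro!: sum_mono)
  qed (rule finite_bounded_exponents)
  define n where "n \<alpha> = (SOME i. d i \<le> \<alpha> $ i)" for \<alpha> :: "nat ^ 'v"
  have n: "d (n \<alpha>) \<le> \<alpha> $ n \<alpha>" if "\<alpha> \<notin> std" for \<alpha>
    unfolding n_def by (rule someI_ex) (use that in \<open>auto simp: std_def not_less\<close>)
  define low where "low \<alpha> = \<alpha> - axis (n \<alpha>) (d (n \<alpha>))" for \<alpha> :: "nat ^ 'v"
  have low: "low \<alpha> + axis (n \<alpha>) (d (n \<alpha>)) = \<alpha>" if "\<alpha> \<notin> std" for \<alpha>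
    using n[OF that] by (auto simp: low_def vec_eq_iff axis_def)
  \<comment> \<open>Since g_i has degree at most d_i, replacing x_i^(d_i) by terms of g_i does not
    raise the degree, so the rewriting stays inside S.\<close>
  have low_deg: "low \<alpha> + e a \<in> S" if "\<alpha> \<in> S" "\<alpha> \<notin> std" "a \<in> I (n \<alpha>)" for \<alpha> a
  proof -
    have "(\<Sum>j\<in>UNIV. \<alpha> $ j) = (\<Sum>j\<in>UNIV. (low \<alpha> + axis (n \<alpha>) (d (n \<alpha>))) $ j)"
      using low[OF that(2)] by simp
    also have "\<dots> = (\<Sum>j\<in>UNIV. low \<alpha> $ j) + d (n \<alpha>)"
      by (simp add: sum.distrib axis_def)
    finally show ?thesis using that(1) deg[OF that(3)] by (simp add: S_def sum.distrib)
  qed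
  \<comment> \<open>For i = \<open>n \<alpha>\<close>, row \<alpha> encodes the i-th perturbed
    equation multiplied by the monomial of \<open>low \<alpha>\<close>: at a perturbed zero the
    terms of g_i add up to -\<epsilon> times the monomial of \<alpha>. Rows of standard exponents
    are 0, in accordance with the vector v below, which vanishes there.\<close>
  define A where "A \<alpha> \<beta> = (if \<alpha> \<in> std then 0
      else \<Sum>a\<in>I (n \<alpha>). if low \<alpha> + e a = \<beta> then c (n \<alpha>) a else 0)" for \<alpha> \<beta>
  define E where
    "E = {l. \<exists>v. (\<exists>s\<in>S. v s \<noteq> 0) \<and> (\<forall>s\<in>S. (\<Sum>t\<in>S. A s t * v t) = l * v s)}"
  have "uminus ` {0<..<\<delta>} \<subseteq> E"
  proof clarify
    fix \<epsilon> assume "\<epsilon> \<in> {0<..<\<delta>}"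
    then have "\<bar>\<epsilon>\<bar> < \<delta>" by simp
    then obtain y where y: "inj_on y Z" "\<And>z. z \<in> Z \<Longrightarrow> g (y z) + \<epsilon> *\<^sub>R h (y z) = 0"
      using \<delta>(2) by blast
    \<comment> \<open>The zeros outnumber the standard monomials, so a nontrivial combination of the
      evaluations vanishes on all standard monomials.\<close>
    have "card std < card Z" using card_std card_Z by simp
    from ex_nontrivial_relation[OF std Z(1) this, of "\<lambda>z \<alpha>. monom_at \<alpha> (y z)"]
    obtain b where b: "\<exists>z\<in>Z. b z \<noteq> 0" "\<forall>\<alpha>\<in>std. (\<Sum>z\<in>Z. b z * monom_at \<alpha> (y z)) = 0"
      by (elim exE conjE) (rule that)
    define v where "v \<gamma> = (\<Sum>z\<in>Z. b z * monom_at \<gamma> (y z))" for \<gamma>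
    have "\<exists>\<gamma>\<in>S. v \<gamma> \<noteq> 0"
    proof (rule ccontr)
      assume "\<not> (\<exists>\<gamma>\<in>S. v \<gamma> \<noteq> 0)"
      then have "\<forall>z\<in>Z. b z = 0"
        by (intro monomials_separate_points[OF Z(1) y(1)]) (auto simp: S_def v_def)
      with b(1) show False by blast
    qed
    moreover have "(\<Sum>\<beta>\<in>S. A \<alpha> \<beta> * v \<beta>) = - \<epsilon> * v \<alpha>" if \<alpha>: "\<alpha> \<in> S" for \<alpha>
    proof (cases "\<alpha> \<in> std")
      case True
      then show ?thesis using b(2) by (simp add: A_def v_def)
    next
      case False
      let ?i = "n \<alpha>"
      have "(\<Sum>\<beta>\<in>S. A \<alpha> \<beta> * v \<beta>)
          = (\<Sum>a\<in>I ?i. \<Sum>\<beta>\<in>S. (if low \<alpha> + e a = \<beta> then c ?i a else 0) * v \<beta>)"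
        using False by (simp add: A_def sum_distrib_right) (rule sum.swap)
      also have "\<dots> = (\<Sum>a\<in>I ?i. c ?i a * v (low \<alpha> + e a))"
      proof (rule sum.cong[OF refl])
        fix a assume "a \<in> I ?i"
        from low_deg[OF \<alpha> False this]
        have "(\<Sum>\<beta>\<in>S. if low \<alpha> + e a = \<beta> then c ?i a * v \<beta> else 0) = c ?i a * v (low \<alpha> + e a)"
          using S by simp
        then show "(\<Sum>\<beta>\<in>S. (if low \<alpha> + e a = \<beta> then c ?i a else 0) * v \<beta>)
            = c ?i a * v (low \<alpha> + e a)"
          by (simp add: if_distrib[of "\<lambda>x. x * _"] cong: if_cong)
      qed
      also have "\<dots> = (\<Sum>z\<in>Z. b z * monom_at (low \<alpha>) (y z) * g (y z) $ ?i)"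
        unfolding v_def g sum_distrib_left
        by (subst sum.swap) (simp add: monom_at_add mult_ac)
      also have "\<dots> = (\<Sum>z\<in>Z. - \<epsilon> * (b z * monom_at \<alpha> (y z)))"
      proof (rule sum.cong[OF refl])
        fix z assume "z \<in> Z"
        then have "(g (y z) + \<epsilon> *\<^sub>R h (y z)) $ ?i = 0" using y(2) by simp
        then have "g (y z) $ ?i = - \<epsilon> * (y z $ ?i) ^ d ?i" by (simp add: h_def)
        moreover have "monom_at \<alpha> (y z) = monom_at (low \<alpha>) (y z) * (y z $ ?i) ^ d ?i"
          using low[OF False] monom_at_add[of "low \<alpha>" "axis ?i (d ?i)" "y z"] by simp
        ultimately show "b z * monom_at (low \<alpha>) (y z) * g (y z) $ ?i
            = - \<epsilon> * (b z * monom_at \<alpha> (y z))" by simp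
      qed
      finally show ?thesis by (simp add: v_def sum_distrib_left)
    qed
    ultimately show "- \<epsilon> \<in> E" unfolding E_def by blast
  qed
  moreover have "finite E" unfolding E_def using S by (rule finite_eigenvalues)
  ultimately have "finite (uminus ` {0<..<\<delta>})" by (rule finite_subset)
  then have "finite {0<..<\<delta>}" by (rule finite_imageD) simp
  with \<delta>(1) show False using infinite_Ioo by blast
qed

section \<open>Volumes of truncated weighted simplices\<close>

lemma sum_UNIV_option: "(\<Sum>i\<in>UNIV. f i) = f None + (\<Sum>s\<in>(UNIV :: 'k::finite set). f (Some s))"
  by (simp add: UNIV_option_conv sum.reindex)

lemma prod_UNIV_option: "(\<Prod>i\<in>UNIV. f i) = f None * (\<Prod>s\<in>(UNIV :: 'k::finite set). f (Some s))"
  by (simp add: UNIV_option_conv prod.reindex)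

lemma shear_unit:
  fixes S :: "(real ^ 'v::finite) set"
  assumes "m \<noteq> n" "S \<in> lmeasurable"
  defines "f \<equiv> (\<lambda>x :: real ^ 'v. \<chi> i. if i = m then x $ m + x $ n else x $ i)"
  shows "f ` S \<in> lmeasurable \<and> measure lebesgue (f ` S) = measure lebesgue S"
proof -
  have lin: "linear f"
    unfolding f_def by (rule linearI) (auto simp: algebra_simps vec_eq_iff)
  have "measure lebesgue (f ` cbox a b) = 1 * measure lebesgue (cbox a b)" for a b
  proof (cases "cbox a b = {}")
    case True
    then show ?thesis by simp
  next
    case False
    \<comment> \<open>\<open>measure_shear_interval\<close> asks for a nonnegative lower bound in
      coordinate n. The translation moves this bound to 0, and the linear map turns it into another
      translation.\<close>
    define u :: "real ^ 'v" where "u = axis n (- a $ n)"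
    have shift: "(+) u ` cbox a b = cbox (u + a) (u + b)" by (simp add: cbox_translation)
    have "f ` cbox (u + a) (u + b) = (+) (f u) ` f ` cbox a b"
      unfolding shift[symmetric] image_image using linear_add[OF lin] by simp
    then have "measure lebesgue (f ` cbox a b) = measure lebesgue (f ` cbox (u + a) (u + b))"
      by (simp only: measure_translation)
    also have "\<dots> = measure lebesgue (cbox (u + a) (u + b))"
      unfolding f_def
    proof (rule measure_shear_interval[OF assms(1)])
      show "cbox (u + a) (u + b) \<noteq> {}" unfolding shift[symmetric] using False by simp
    qed (simp add: u_def)
    also have "\<dots> = measure lebesgue (cbox a b)"
      unfolding shift[symmetric] by (rule measure_translation)
    finally show ?thesis by simp
  qed
  from measure_linear_sufficient[OF lin assms(2) this] show ?thesis by simp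
qed

lemma shear_sum:
  fixes S :: "(real ^ 'v::finite) set"
  assumes "finite A" "m \<notin> A" "S \<in> lmeasurable"
  defines "f \<equiv> (\<lambda>x :: real ^ 'v. \<chi> i. if i = m then x $ m + (\<Sum>s\<in>A. x $ s) else x $ i)"
  shows "f ` S \<in> lmeasurable \<and> measure lebesgue (f ` S) = measure lebesgue S"
  using assms(1,2) unfolding f_def
proof (induction A rule: finite_induct)
  case empty
  have eq: "(\<lambda>x :: real ^ 'v. \<chi> i. if i = m then x $ m + (\<Sum>s\<in>{}. x $ s) else x $ i) = (\<lambda>x. x)"
    by (auto simp: fun_eq_iff vec_eq_iff)
  show ?case unfolding eq using assms(3) by simp
next
  case (insert n A)
  let ?f = "\<lambda>A (x :: real ^ 'v). \<chi> i. if i = m then x $ m + (\<Sum>s\<in>A. x $ s) else x $ i"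
  let ?g = "\<lambda>x :: real ^ 'v. \<chi> i. if i = m then x $ m + x $ n else x $ i"
  have "?f (insert n A) ` S = ?g ` ?f A ` S"
    unfolding image_image using insert.hyps insert.prems by (intro image_cong) (auto simp: vec_eq_iff)
  moreover have "m \<noteq> n" using insert.prems by auto
  ultimately show ?case
    using shear_unit[of m n "?f A ` S"] insert.IH insert.prems by simp
qed

text \<open>Conjugation by a dilation: scaling coordinate m by 1/c before the shear and by c after
  it turns the factor c into 1, and the two volume factors cancel.\<close>

lemma shear:
  fixes S :: "(real ^ 'v::finite) set" and c :: real
  assumes "m \<notin> A" "S \<in> lmeasurable"
  defines "f \<equiv> (\<lambda>x :: real ^ 'v. \<chi> i. if i = m then x $ m + c * (\<Sum>s\<in>A. x $ s) else x $ i)"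
  shows "f ` S \<in> lmeasurable \<and> measure lebesgue (f ` S) = measure lebesgue S"
proof (cases "c = 0")
  case True
  then have "f = (\<lambda>x. x)" by (auto simp: f_def fun_eq_iff vec_eq_iff)
  then show ?thesis using assms(2) by simp
next
  case False
  let ?d = "\<lambda>r (x :: real ^ 'v). \<chi> i. (if i = m then r else 1) * x $ i"
  let ?g = "\<lambda>x :: real ^ 'v. \<chi> i. if i = m then x $ m + (\<Sum>s\<in>A. x $ s) else x $ i"
  have prod: "(\<Prod>i\<in>UNIV. if i = m then r else 1) = r" for r :: real by simp
  have sum: "(\<Sum>s\<in>A. ?d r x $ s) = (\<Sum>s\<in>A. x $ s)" for r x
    using assms(1) by (intro sum.cong) auto
  have "f ` S = ?d c ` ?g ` ?d (1 / c) ` S"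
    unfolding image_image f_def using False sum
    by (intro image_cong) (auto simp: vec_eq_iff distrib_left)
  moreover have 1: "?d (1 / c) ` S \<in> lmeasurable"
      "measure lebesgue (?d (1 / c) ` S) = \<bar>1 / c\<bar> * measure lebesgue S"
    using measurable_stretch[OF assms(2), of "\<lambda>i. if i = m then 1 / c else 1"]
      measure_stretch[OF assms(2), of "\<lambda>i. if i = m then 1 / c else 1"] unfolding prod by auto
  moreover note 2 = shear_sum[OF finite assms(1) 1(1)]
  moreover have "?d c ` ?g ` ?d (1 / c) ` S \<in> lmeasurable"
      "measure lebesgue (?d c ` ?g ` ?d (1 / c) ` S) = \<bar>c\<bar> * measure lebesgue (?g ` ?d (1 / c) ` S)"
    using measurable_stretch[OF conjunct1[OF 2], of "\<lambda>i. if i = m then c else 1"]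
      measure_stretch[OF conjunct1[OF 2], of "\<lambda>i. if i = m then c else 1"] unfolding prod by auto
  ultimately show ?thesis using False by (simp add: abs_divide)
qed

section \<open>Weighted simplices and their corners\<close>

lemma std_simplex_vec:
  "convex hull (insert 0 Basis) = {x :: real ^ 'v::finite. (\<forall>i. 0 \<le> x $ i) \<and> (\<Sum>i\<in>UNIV. x $ i) \<le> 1}"
proof -
  have "(\<Sum>b\<in>Basis. x \<bullet> b) = (\<Sum>i\<in>UNIV. x $ i)" for x :: "real ^ 'v"
  proof -
    have "(\<Sum>b\<in>Basis. x \<bullet> b) = (\<Sum>b\<in>(\<lambda>i. axis i 1) ` UNIV. x \<bullet> b)"
      by (rule sum.cong) (auto simp: Basis_vec_def)
    also have "\<dots> = (\<Sum>i\<in>UNIV. x \<bullet> axis i 1)"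
      by (subst sum.reindex) (auto simp: inj_on_def axis_eq_axis)
    finally show ?thesis by (simp add: inner_axis)
  qed
  moreover have "(\<forall>b\<in>Basis. 0 \<le> x \<bullet> b) \<longleftrightarrow> (\<forall>i. 0 \<le> x $ i)" for x :: "real ^ 'v"
    by (auto simp: Basis_vec_def inner_axis)
  ultimately show ?thesis unfolding std_simplex by auto
qed

lemma std_simplex_measurable: "convex hull (insert 0 Basis :: (real ^ 'v::finite) set) \<in> lmeasurable"
  by (intro measurable_convex convex_convex_hull finite_imp_bounded_convex_hull) simp

lemma measure_std_simplex:
  "measure lebesgue (convex hull (insert 0 Basis :: (real ^ 'v::finite) set)) = 1 / fact CARD('v)"
proof -
  have "compact (convex hull (insert 0 Basis :: (real ^ 'v) set))"
    by (intro compact_convex_hull finite_imp_compact) simp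
  then have "convex hull (insert 0 Basis :: (real ^ 'v) set) \<in> sets lborel"
    by (simp add: borel_compact)
  then show ?thesis using content_std_simplex[where ?'a = "real ^ 'v"] by simp
qed

abbreviation tail :: "'a::comm_monoid_add ^ ('k::finite) option \<Rightarrow> 'a" where
  "tail x \<equiv> (\<Sum>s\<in>UNIV. x $ Some s)"

definition wsimplex :: "real \<Rightarrow> (real ^ ('k::finite) option) set" where
  "wsimplex T = {x. (\<forall>i. 0 \<le> x $ i) \<and> 2 * x $ None + tail x \<le> T}"

text \<open>The cutting hyperplane meets the facet \<open>2 * x $ None + tail x = T\<close> where \<open>tail x = z\<close>.\<close>

definition trunc_simplex :: "real \<Rightarrow> real \<Rightarrow> real \<Rightarrow> (real ^ ('k::finite) option) set" where
  "trunc_simplex c T z =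
     {x \<in> wsimplex T. 2 * x $ None - c * tail x \<le> T - (c + 1) * z}"

text \<open>The corner at (T/2, 0) that the truncation removes, taken closed so that both pieces
  share the cutting hyperplane.\<close>

definition cut_simplex :: "real \<Rightarrow> real \<Rightarrow> real \<Rightarrow> (real ^ ('k::finite) option) set" where
  "cut_simplex c T z =
     {x \<in> wsimplex T. 2 * x $ None - c * tail x \<ge> T - (c + 1) * z}"

lemma tail_nonneg: "(\<And>i. 0 \<le> x $ i) \<Longrightarrow> 0 \<le> tail (x :: real ^ ('k::finite) option)"
  by (simp add: sum_nonneg)

lemma tail_le: "(\<And>i. 0 \<le> x $ i) \<Longrightarrow> x $ Some s \<le> tail (x :: real ^ ('k::finite) option)"
  by (rule member_le_sum) auto

lemma tail_scale:
  fixes x y :: "real ^ ('k::finite) option"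
  shows "(\<And>s. x $ Some s = z * y $ Some s) \<Longrightarrow> tail x = z * tail y"
  by (simp add: sum_distrib_left)

lemma wsimplex_eq_image:
  fixes T :: real
  assumes "T > 0"
  shows "(wsimplex T :: (real ^ ('k::finite) option) set) =
    (\<lambda>x. \<chi> i. (case i of None \<Rightarrow> T / 2 | Some _ \<Rightarrow> T) * x $ i) ` (convex hull (insert 0 Basis))"
    (is "_ = ?f ` ?U")
proof (intro equalityI subsetI)
  fix x :: "real ^ 'k option" assume x: "x \<in> wsimplex T"
  define y :: "real ^ 'k option" where "y = (\<chi> i. x $ i / (case i of None \<Rightarrow> T / 2 | Some _ \<Rightarrow> T))"
  have "x = ?f y" using assms by (auto simp: y_def vec_eq_iff split: option.split)
  moreover have "(\<Sum>i\<in>UNIV. y $ i) = (2 * x $ None + tail x) / T"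
    by (simp add: sum_UNIV_option y_def add_divide_distrib sum_divide_distrib)
  then have "y \<in> ?U" using x assms
    by (auto simp: std_simplex_vec wsimplex_def y_def split: option.split)
  ultimately show "x \<in> ?f ` ?U" by blast
next
  fix x assume "x \<in> ?f ` ?U"
  then obtain y where y: "\<forall>i. 0 \<le> y $ i" "y $ None + tail y \<le> 1" "x = ?f y"
    by (auto simp: std_simplex_vec sum_UNIV_option)
  have "2 * x $ None + tail x = T * (y $ None + tail y)"
    by (simp add: y(3) sum_distrib_left distrib_left)
  also have "\<dots> \<le> T" using y(2) assms by (simp add: mult_left_le)
  finally show "x \<in> wsimplex T"
    using y(1) assms by (auto simp: wsimplex_def y(3) split: option.split)
qed

text \<open>Size 0 arises from the Minkowski combination with all factors 0, which
  \<open>volume_poly\<close> admits; dividing by T is then impossible.\<close>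

lemma wsimplex_0: "wsimplex 0 = {0 :: real ^ ('k::finite) option}"
proof (intro equalityI subsetI)
  fix x :: "real ^ 'k option" assume "x \<in> wsimplex 0"
  then have x: "\<And>i. 0 \<le> x $ i" "2 * x $ None + tail x \<le> 0" by (auto simp: wsimplex_def)
  have "x $ i = 0" for i
  proof (cases i)
    case None
    then show ?thesis using x(1)[of None] x(2) tail_nonneg[OF x(1)] by simp
  next
    case (Some s)
    then show ?thesis using x(1)[of None] x(1)[of i] x(2) tail_le[OF x(1), of s] by simp
  qed
  then show "x \<in> {0}" by (simp add: vec_eq_iff)
qed (simp add: wsimplex_def)

lemma measure_wsimplex:
  assumes "T \<ge> 0"
  shows "(wsimplex T :: (real ^ ('k::finite) option) set) \<in> lmeasurable"
    and "measure lebesgue (wsimplex T :: (real ^ 'k option) set)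
      = T ^ CARD('k option) / (2 * fact CARD('k option))"
proof (atomize(full), cases "T = 0")
  case True
  then show "(wsimplex T :: (real ^ 'k option) set) \<in> lmeasurable \<and> measure lebesgue (wsimplex T :: (real ^ 'k option) set)
      = T ^ CARD('k option) / (2 * fact CARD('k option))"
    using lmeasurable_cbox[of "0 :: real ^ 'k option" 0] by (simp add: wsimplex_0 card_UNIV_option)
next
  case False
  with assms have T: "T > 0" by simp
  show "(wsimplex T :: (real ^ 'k option) set) \<in> lmeasurable \<and> measure lebesgue (wsimplex T :: (real ^ 'k option) set)
      = T ^ CARD('k option) / (2 * fact CARD('k option))"
    unfolding wsimplex_eq_image[OF T]
    using measurable_stretch[OF std_simplex_measurable,
        of "\<lambda>i :: 'k option. case i of None \<Rightarrow> T / 2 | Some _ \<Rightarrow> T"]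
      measure_stretch[OF std_simplex_measurable,
        of "\<lambda>i :: 'k option. case i of None \<Rightarrow> T / 2 | Some _ \<Rightarrow> T"]
      T unfolding measure_std_simplex
    by (simp add: abs_mult prod_UNIV_option card_UNIV_option)
qed

text \<open>The corner is itself a simplex, with vertices ((T - (c + 1) z)/2, 0) and (T/2, 0) on the
  axis and ((T - z)/2, z e_j) for each j. The stretch fixes the edge lengths, the shear gives the
  base the slope of the cut, and the translation raises the lower axis vertex to its height.\<close>

lemma cut_simplex_eq_image:
  fixes c T z :: real
  assumes "c \<ge> 0" "z > 0" "(c + 1) * z \<le> T"
  shows "(cut_simplex c T z :: (real ^ ('k::finite) option) set) =
    (+) (axis None ((T - (c + 1) * z) / 2)) `
    (\<lambda>x. \<chi> i. if i = None then x $ None + c / 2 * (\<Sum>s\<in>range Some. x $ s) else x $ i) `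
    (\<lambda>x. \<chi> i. (case i of None \<Rightarrow> (c + 1) * z / 2 | Some _ \<Rightarrow> z) * x $ i) `
    (convex hull (insert 0 Basis))"
    (is "_ = ?t ` ?s ` ?d ` ?U")
proof (intro equalityI subsetI)
  have tsd: "?t (?s (?d y)) $ None
      = (T - (c + 1) * z) / 2 + (c + 1) * z / 2 * y $ None + c / 2 * z * tail y"
    "?t (?s (?d y)) $ Some s = z * y $ Some s" for y s
    by (auto simp: sum.reindex sum_distrib_left axis_def mult_ac)
  {
    fix x :: "real ^ 'k option" assume x: "x \<in> cut_simplex c T z"
    define y :: "real ^ 'k option" where
      "y = (\<chi> i. case i of None \<Rightarrow> (2 * x $ None - c * tail x - (T - (c + 1) * z)) / ((c + 1) * z)
                       | Some s \<Rightarrow> x $ Some s / z)"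
    have tail_y: "tail y = tail x / z" by (simp add: y_def sum_divide_distrib)
    have "(c + 1) * z \<noteq> 0" using assms by simp
    then have None_y: "(c + 1) * z * y $ None = 2 * x $ None - c * tail x - (T - (c + 1) * z)"
      by (simp add: y_def)
    have "?t (?s (?d y)) $ i = x $ i" for i
    proof (cases i)
      case None
      have "?t (?s (?d y)) $ None
          = (T - (c + 1) * z) / 2 + (c + 1) * z * y $ None / 2 + c * (z * tail y) / 2"
        unfolding tsd(1) by simp
      also have "\<dots> = x $ None"
        unfolding None_y tail_y using assms(2) by (simp add: field_simps)
      finally show ?thesis unfolding None .
    next
      case (Some s)
      show ?thesis unfolding Some tsd(2) using assms(2) by (simp add: y_def)
    qed
    then have "x = ?t (?s (?d y))" by (simp add: vec_eq_iff)
    moreover have "y \<in> ?U"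
    proof -
      have "(c + 1) * z * (y $ None + tail y) = (c + 1) * z * y $ None + (c + 1) * tail x"
        unfolding tail_y using assms(2) by (simp add: distrib_left)
      also have "\<dots> = 2 * x $ None + tail x - (T - (c + 1) * z)"
        unfolding None_y by (simp add: algebra_simps)
      also have "\<dots> \<le> (c + 1) * z * 1"
        using x by (simp add: cut_simplex_def wsimplex_def)
      finally have "(c + 1) * z * (y $ None + tail y) \<le> (c + 1) * z * 1" .
      then have "y $ None + tail y \<le> 1"
        by (rule mult_left_le_imp_le) (use assms in simp)
      moreover have "0 \<le> y $ i" for i
        using x assms
        by (auto simp: cut_simplex_def wsimplex_def y_def split: option.split)
      ultimately show ?thesis by (simp add: std_simplex_vec sum_UNIV_option)
    qed
    ultimately show "x \<in> ?t ` ?s ` ?d ` ?U" by blast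
  next
    fix x assume "x \<in> ?t ` ?s ` ?d ` ?U"
    then obtain y where y: "\<forall>i. 0 \<le> y $ i" "y $ None + tail y \<le> 1" "x = ?t (?s (?d y))"
      by (auto simp: std_simplex_vec sum_UNIV_option)
    have x: "x $ None = (T - (c + 1) * z) / 2 + (c + 1) * z / 2 * y $ None + c / 2 * z * tail y"
        "\<And>s. x $ Some s = z * y $ Some s" using tsd y(3) by simp_all
    have tail_x: "tail x = z * tail y" using x(2) by (rule tail_scale)
    have pos: "0 \<le> y $ None" "0 \<le> tail y" using y(1) tail_nonneg by auto
    have "2 * x $ None + tail x = T - (c + 1) * z + (c + 1) * z * (y $ None + tail y)"
      unfolding tail_x x(1) by (simp add: field_simps)
    also have "\<dots> \<le> T" using y(2) assms by (simp add: mult_left_le)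
    finally have "2 * x $ None + tail x \<le> T" .
    moreover have "2 * x $ None - c * tail x = T - (c + 1) * z + (c + 1) * z * y $ None"
      unfolding tail_x x(1) by (simp add: field_simps)
    then have "2 * x $ None - c * tail x \<ge> T - (c + 1) * z" using pos assms by simp
    moreover have "0 \<le> x $ i" for i
      using x pos assms y(1) by (cases i) simp_all
    ultimately show "x \<in> cut_simplex c T z" by (simp add: cut_simplex_def wsimplex_def)
  }
qed

text \<open>Only the stretch changes the volume. The result depends on z and not on T, which lets
  the volume of a truncated simplex split into powers of two linear forms.\<close>

lemma measure_cut_simplex:
  fixes c T z :: real
  assumes "c \<ge> 0" "z > 0" "(c + 1) * z \<le> T"
  shows "(cut_simplex c T z :: (real ^ ('k::finite) option) set) \<in> lmeasurable"
    and "measure lebesgue (cut_simplex c T z :: (real ^ 'k option) set)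
      = (c + 1) * z ^ CARD('k option) / (2 * fact CARD('k option))"
proof -
  let ?d = "\<lambda>x :: real ^ 'k option. \<chi> i. (case i of None \<Rightarrow> (c + 1) * z / 2 | Some _ \<Rightarrow> z) * x $ i"
  let ?U = "convex hull (insert 0 Basis) :: (real ^ 'k option) set"
  have d: "?d ` ?U \<in> lmeasurable"
      "measure lebesgue (?d ` ?U) = (c + 1) * z ^ CARD('k option) / (2 * fact CARD('k option))"
    using measurable_stretch[OF std_simplex_measurable,
        of "\<lambda>i :: 'k option. case i of None \<Rightarrow> (c + 1) * z / 2 | Some _ \<Rightarrow> z"]
      measure_stretch[OF std_simplex_measurable,
        of "\<lambda>i :: 'k option. case i of None \<Rightarrow> (c + 1) * z / 2 | Some _ \<Rightarrow> z"]
      assms unfolding measure_std_simplex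
    by (simp_all add: abs_mult prod_UNIV_option card_UNIV_option)
  have "None \<notin> range Some" by simp
  note s = shear[OF this d(1), of "c / 2"]
  show "(cut_simplex c T z :: (real ^ 'k option) set) \<in> lmeasurable"
    unfolding cut_simplex_eq_image[OF assms] by (rule measurable_translation[OF conjunct1[OF s]])
  show "measure lebesgue (cut_simplex c T z :: (real ^ 'k option) set)
      = (c + 1) * z ^ CARD('k option) / (2 * fact CARD('k option))"
    unfolding cut_simplex_eq_image[OF assms] measure_translation using s d(2) by simp
qed

lemma convex_halfspace_linear: "linear f \<Longrightarrow> convex {x. f x \<le> (b :: real)}"
  using convex_linear_vimage[of f "{..b}"] by (simp add: vimage_def)

lemma convex_trunc_simplex: "convex (trunc_simplex c T z :: (real ^ ('k::finite) option) set)"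
proof -
  have "(trunc_simplex c T z :: (real ^ 'k option) set) = (\<Inter>i. {x. - (x $ i) \<le> 0}) \<inter> {x. 2 * x $ None + tail x \<le> T}
      \<inter> {x. 2 * x $ None - c * tail x \<le> T - (c + 1) * z}"
    by (auto simp: trunc_simplex_def wsimplex_def)
  moreover have "convex (\<Inter>i. {x :: real ^ 'k option. - (x $ i) \<le> 0})"
    by (intro convex_INT convex_halfspace_linear linearI) auto
  moreover have "convex {x :: real ^ 'k option. 2 * x $ None + tail x \<le> T}"
    by (intro convex_halfspace_linear linearI) (auto simp: sum.distrib sum_distrib_left algebra_simps)
  moreover have "convex {x :: real ^ 'k option. 2 * x $ None - c * tail x \<le> T - (c + 1) * z}"
    by (intro convex_halfspace_linear linearI) (auto simp: sum.distrib sum_distrib_left algebra_simps)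
  ultimately show ?thesis by (simp only: convex_Int)
qed

lemma measure_trunc_simplex:
  fixes c T z :: real
  assumes "c \<ge> 0" "z \<ge> 0" "(c + 1) * z \<le> T"
  shows "measure lebesgue (trunc_simplex c T z :: (real ^ ('k::finite) option) set)
    = (T ^ CARD('k option) - (c + 1) * z ^ CARD('k option)) / (2 * fact CARD('k option))"
proof (cases "z = 0")
  case True
  \<comment> \<open>Nothing is cut off: on the nonnegative orthant the second inequality follows
    from the first.\<close>
  have "trunc_simplex c T 0 = (wsimplex T :: (real ^ 'k option) set)"
  proof -
    have "2 * x $ None - c * tail x \<le> T" if "x \<in> wsimplex T" for x :: "real ^ 'k option"
    proof -
      have "\<forall>i. 0 \<le> x $ i" "2 * x $ None + tail x \<le> T" using that by (auto simp: wsimplex_def)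
      moreover from this have "0 \<le> tail x" using tail_nonneg by auto
      moreover from this assms(1) have "0 \<le> c * tail x" by simp
      ultimately show ?thesis by linarith
    qed
    then show ?thesis by (auto simp: trunc_simplex_def)
  qed
  moreover have "T \<ge> 0" using True assms by simp
  ultimately show ?thesis using True measure_wsimplex[where ?'k = 'k] by (simp add: card_UNIV_option)
next
  case False
  with assms have z: "z > 0" by simp
  have "0 \<le> (c + 1) * z" using assms by simp
  with assms(3) have T: "T \<ge> 0" by (rule order_trans[rotated])
  let ?G = "trunc_simplex c T z :: (real ^ 'k option) set"
  let ?C = "cut_simplex c T z :: (real ^ 'k option) set"
  have W: "wsimplex T = ?G \<union> ?C"
  proof (rule set_eqI)
    fix x :: "real ^ 'k option"
    show "x \<in> wsimplex T \<longleftrightarrow> x \<in> ?G \<union> ?C"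
      unfolding trunc_simplex_def cut_simplex_def Un_iff mem_Collect_eq
      using linear[of "2 * x $ None - c * tail x" "T - (c + 1) * z"] by blast
  qed
  have "?G \<in> lmeasurable"
  proof (rule measurable_convex[OF convex_trunc_simplex])
    have "x \<in> cbox 0 (\<chi> i. T)" if "x \<in> ?G" for x
    proof -
      from that have x: "\<And>i. 0 \<le> x $ i" "2 * x $ None + tail x \<le> T"
        by (auto simp: trunc_simplex_def wsimplex_def)
      have "x $ i \<le> T" for i
      proof (cases i)
        case None
        then show ?thesis using x(1)[of None] x(2) tail_nonneg[OF x(1)] by simp
      next
        case (Some s)
        then show ?thesis using x(1)[of None] x(2) tail_le[OF x(1), of s] by simp
      qed
      with x(1) show ?thesis by (simp add: mem_box_cart)
    qed
    then have "?G \<subseteq> cbox 0 (\<chi> i. T)" by (rule subsetI)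
    with bounded_cbox show "bounded ?G" by (rule bounded_subset)
  qed
  moreover have "negligible (?G \<inter> ?C)"
  proof (rule negligible_subset)
    let ?a = "\<chi> i. case i of None \<Rightarrow> 2 | Some _ \<Rightarrow> - c :: real ^ 'k option"
    have "?a $ None \<noteq> 0" by simp
    then have "?a \<noteq> 0" by (metis zero_index)
    then show "negligible {x. ?a \<bullet> x = T - (c + 1) * z}" by (intro negligible_hyperplane) simp
    show "?G \<inter> ?C \<subseteq> {x. ?a \<bullet> x = T - (c + 1) * z}"
      by (auto simp: trunc_simplex_def cut_simplex_def inner_vec_def sum_UNIV_option
          sum_negf sum_distrib_left)
  qed
  ultimately have "measure lebesgue (?G \<union> ?C) = measure lebesgue ?G + measure lebesgue ?C"
    using measure_cut_simplex(1)[OF assms(1) z assms(3), where ?'k = 'k]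
    by (simp add: measure_Un3 negligible_imp_measure0)
  then show ?thesis
    unfolding W[symmetric] measure_wsimplex(2)[OF T] measure_cut_simplex(2)[OF assms(1) z assms(3)]
    by (simp add: diff_divide_distrib)
qed

section \<open>Mixed volumes of truncated weighted simplices\<close>

text \<open>Unlike \<open>exp_pair\<close>, available for real entries as well, so that lattice
  vertices and their real images have the same form.\<close>

definition opt_vec :: "'a \<Rightarrow> ('k \<Rightarrow> 'a) \<Rightarrow> 'a ^ ('k::finite) option" where
  "opt_vec a b = (\<chi> i. case i of None \<Rightarrow> a | Some s \<Rightarrow> b s)"

lemma opt_vec_nth [simp]: "opt_vec a b $ None = a" "opt_vec a b $ Some s = b s"
  by (simp_all add: opt_vec_def)

lemma vec_option_eqI:
  "x $ None = y $ None \<Longrightarrow> (\<And>s. x $ Some s = y $ Some s) \<Longrightarrow> x = (y :: 'a ^ ('k::finite) option)"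
  by (metis option.exhaust vec_eq_iff)

definition delta :: "'k \<Rightarrow> 'a \<Rightarrow> 'k \<Rightarrow> 'a::zero" where
  "delta j t s = (if s = j then t else 0)"

text \<open>b is the combination of the corners \<open>delta j t\<close> with weights b_j / t, so on
  each slice only corners have to be checked.\<close>

lemma convex_contains_slice:
  fixes V :: "(real ^ ('k::finite) option) set"
  assumes "convex V" and "\<And>j. opt_vec a (delta j t) \<in> V"
    and b: "\<And>s. 0 \<le> b s" "sum b UNIV = t"
  shows "opt_vec a b \<in> V"
proof (cases "t = 0")
  case True
  with b have "b s = 0" for s by (simp add: sum_nonneg_eq_0_iff)
  then have "b = delta j t" for j using True by (auto simp: delta_def)
  with assms(2) show ?thesis by metis
next
  case False
  have t: "t > 0" using False b sum_nonneg[of UNIV b] by force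
  have "(\<Sum>j\<in>UNIV. (b j / t) *\<^sub>R opt_vec a (delta j t)) \<in> V"
    using assms b t by (intro convex_sum) (simp_all flip: sum_divide_distrib)
  also have "(\<Sum>j\<in>UNIV. (b j / t) *\<^sub>R opt_vec a (delta j t)) = opt_vec a b"
  proof (rule vec_option_eqI)
    show "(\<Sum>j\<in>UNIV. (b j / t) *\<^sub>R opt_vec a (delta j t)) $ None = opt_vec a b $ None"
      using b(2) t by (simp flip: sum_distrib_right sum_divide_distrib)
    have "(\<Sum>j\<in>UNIV. b j / t * delta j t s) = (\<Sum>j\<in>UNIV. if j = s then b j else 0)" for s
      using t by (intro sum.cong) (auto simp: delta_def)
    then show "(\<Sum>j\<in>UNIV. (b j / t) *\<^sub>R opt_vec a (delta j t)) $ Some s = opt_vec a b $ Some s" for s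
      by simp
  qed
  finally show ?thesis .
qed

text \<open>The points required in V are the vertices. A point with tail entries b lies on the
  segment over b between the floor, at height 0, and the roof. The roof is the cut where the tail
  sum is below z and the slanted facet beyond; floor and roof are reached by interpolating between
  vertices in proportion to b.\<close>

lemma trunc_simplex_subset_convex:
  fixes V :: "(real ^ ('k::finite) option) set"
  assumes cz: "c \<ge> 0" "z \<ge> 0" "(c + 1) * z \<le> T"
    and V: "convex V" "0 \<in> V"
      "\<And>j. opt_vec 0 (delta j T) \<in> V"
      "\<And>j. opt_vec ((T - z) / 2) (delta j z) \<in> V"
      "opt_vec ((T - (c + 1) * z) / 2) (\<lambda>_. 0) \<in> V"
  shows "trunc_simplex c T z \<subseteq> V"
proof
  fix x :: "real ^ 'k option" assume "x \<in> trunc_simplex c T z"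
  then have x: "\<And>i. 0 \<le> x $ i" "2 * x $ None + tail x \<le> T"
      "2 * x $ None - c * tail x \<le> T - (c + 1) * z"
    by (auto simp: trunc_simplex_def wsimplex_def)
  define b where "b s = x $ Some s" for s
  define t where "t = tail x"
  have b: "\<And>s. 0 \<le> b s" "sum b UNIV = t" using x(1) by (auto simp: b_def t_def)
  have t: "0 \<le> t" using b by (metis sum_nonneg)
  have T: "t \<le> T" using x(1)[of None] x(2) by (simp add: t_def)
  have "z \<le> (c + 1) * z" using cz by (simp add: mult_right_mono[of 1 "c + 1" z, simplified])
  with cz have zT: "z \<le> T" by linarith
  have scaled: "opt_vec a (\<lambda>s. r / t * b s) \<in> V"
    if "\<And>j. opt_vec a (delta j r) \<in> V" "t > 0" "r \<ge> 0" for a r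
  proof (rule convex_contains_slice[OF V(1) that(1)])
    show "(\<Sum>s\<in>UNIV. r / t * b s) = r"       unfolding sum_distrib_left[symmetric] b(2) using that by simp
  qed (use b that in auto)
  have bot: "opt_vec 0 b \<in> V"
  proof (cases "t = 0")
    case True
    with b have "b s = 0" for s by (simp add: sum_nonneg_eq_0_iff)
    then have "opt_vec 0 b = 0" by (intro vec_option_eqI) auto
    with V(2) show ?thesis by simp
  next
    case False
    with t have tp: "t > 0" by simp
    have "(t / T) *\<^sub>R opt_vec 0 (\<lambda>s. T / t * b s) + (1 - t / T) *\<^sub>R 0 \<in> V"
      using scaled[OF V(3) tp] V tp T by (intro convexD) auto
    also have "(t / T) *\<^sub>R opt_vec 0 (\<lambda>s. T / t * b s) + (1 - t / T) *\<^sub>R 0 = opt_vec 0 b"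
      using tp T by (intro vec_option_eqI) auto
    finally show ?thesis .
  qed
  have top: "\<exists>a \<ge> x $ None. opt_vec a b \<in> V"
  proof -
    \<comment> \<open>The last case is degenerate: z = T > 0 forces c = 0, and the roof comes down
      to the floor.\<close>
    consider "t = 0" | "t > 0" "t < z" | "t > 0" "z \<le> t" "z < T" | "t > 0" "z = T"
      using t zT by linarith
    then show ?thesis
    proof cases
      case 1
      with b have "b s = 0" for s by (simp add: sum_nonneg_eq_0_iff)
      then have "opt_vec a b = opt_vec a (\<lambda>_. 0)" for a by (intro vec_option_eqI) auto
      moreover have "x $ None \<le> (T - (c + 1) * z) / 2" using x(3) 1 by (simp add: t_def)
      ultimately show ?thesis using V(5) by metis
    next
      case 2
      let ?a = "(T - (c + 1) * z + c * t) / 2"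
      have "(t / z) *\<^sub>R opt_vec ((T - z) / 2) (\<lambda>s. z / t * b s)
          + (1 - t / z) *\<^sub>R opt_vec ((T - (c + 1) * z) / 2) (\<lambda>_. 0) \<in> V"
        using scaled[OF V(4)] V 2 by (intro convexD) auto
      also have "(t / z) *\<^sub>R opt_vec ((T - z) / 2) (\<lambda>s. z / t * b s)
          + (1 - t / z) *\<^sub>R opt_vec ((T - (c + 1) * z) / 2) (\<lambda>_. 0) = opt_vec ?a b"
        using 2 by (intro vec_option_eqI) (auto simp: field_simps)
      finally have "opt_vec ?a b \<in> V" .
      moreover have "x $ None \<le> ?a" using x(3) by (simp add: t_def)
      ultimately show ?thesis by blast
    next
      case 3
      let ?a = "(T - t) / 2"
      \<comment> \<open>The weight at which the tail sums z and T average to t.\<close>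
      define u where "u = (T - t) / (T - z)"
      have u: "0 \<le> u" "u \<le> 1" "u * (T - z) = T - t"
        using 3 T by (simp_all add: u_def)
      have "u *\<^sub>R opt_vec ((T - z) / 2) (\<lambda>s. z / t * b s)
          + (1 - u) *\<^sub>R opt_vec 0 (\<lambda>s. T / t * b s) \<in> V"
        using scaled[OF V(4)] scaled[OF V(3)] V 3 cz T u by (intro convexD) auto
      also have "u *\<^sub>R opt_vec ((T - z) / 2) (\<lambda>s. z / t * b s)
          + (1 - u) *\<^sub>R opt_vec 0 (\<lambda>s. T / t * b s) = opt_vec ?a b"
      proof (rule vec_option_eqI)
        fix s
        have "u * z + (1 - u) * T = T - u * (T - z)" by (simp add: algebra_simps)
        also have "\<dots> = t" using u(3) by simp
        finally have "u * z + (1 - u) * T = t" .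
        then have "(u * z + (1 - u) * T) / t * b s = b s" using 3 by simp
        then show "(u *\<^sub>R opt_vec ((T - z) / 2) (\<lambda>s. z / t * b s)
            + (1 - u) *\<^sub>R opt_vec 0 (\<lambda>s. T / t * b s)) $ Some s = opt_vec ?a b $ Some s"
          by (simp add: add_divide_distrib distrib_right)
      qed (use u(3) in simp)
      finally have "opt_vec ?a b \<in> V" .
      moreover have "x $ None \<le> ?a" using x(2) by (simp add: t_def)
      ultimately show ?thesis by blast
    next
      case 4
      have "c * z \<le> 0" using cz 4 by (simp add: algebra_simps)
      moreover have "z > 0" using 4 T by simp
      ultimately have "c = 0" using cz by (simp add: mult_le_0_iff)
      then have "x $ None \<le> 0" using x(3) 4 by simp
      with bot show ?thesis by blast
    qed
  qed
  then obtain a where a: "a \<ge> x $ None" "opt_vec a b \<in> V" by blast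
  have x_eq: "x = opt_vec (x $ None) b" by (intro vec_option_eqI) (simp_all add: b_def)
  show "x \<in> V"
  proof (cases "a = 0")
    case True
    then have "x $ None = 0" using a x(1)[of None] by simp
    with bot x_eq show ?thesis by simp
  next
    case False
    then have "a > 0" using a x(1)[of None] by simp
    have "(x $ None / a) *\<^sub>R opt_vec a b + (1 - x $ None / a) *\<^sub>R opt_vec 0 b \<in> V"
      using V(1) a bot x(1) \<open>a > 0\<close> by (intro convexD) auto
    also have "(x $ None / a) *\<^sub>R opt_vec a b + (1 - x $ None / a) *\<^sub>R opt_vec 0 b
        = opt_vec (x $ None) b"
      using \<open>a > 0\<close> by (intro vec_option_eqI) (auto simp: algebra_simps)
    finally show ?thesis using x_eq by simp
  qed
qed

section \<open>Minkowski combinations\<close>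

lemma convex_mink_comb:
  assumes "\<And>i. convex (P i)"
  shows "convex (mink_comb P l)"
proof (rule convexI)
  fix p q and u v :: real
  assume p: "p \<in> mink_comb P l" and q: "q \<in> mink_comb P l" and uv: "0 \<le> u" "0 \<le> v" "u + v = 1"
  obtain x where x: "p = (\<Sum>i\<in>UNIV. l $ i *\<^sub>R x i)" "\<forall>i. x i \<in> P i"
    using p by (auto simp: mink_comb_def)
  obtain y where y: "q = (\<Sum>i\<in>UNIV. l $ i *\<^sub>R y i)" "\<forall>i. y i \<in> P i"
    using q by (auto simp: mink_comb_def)
  have "u *\<^sub>R p + v *\<^sub>R q = (\<Sum>i\<in>UNIV. l $ i *\<^sub>R (u *\<^sub>R x i + v *\<^sub>R y i))"
    by (simp add: x(1) y(1) scaleR_right_distrib sum.distrib scaleR_sum_right mult.commute)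
  moreover have "\<forall>i. u *\<^sub>R x i + v *\<^sub>R y i \<in> P i"
    using assms x(2) y(2) uv by (auto intro: convexD)
  ultimately show "u *\<^sub>R p + v *\<^sub>R q \<in> mink_comb P l"
    unfolding mink_comb_def mem_Collect_eq by (intro exI[of _ "\<lambda>i. u *\<^sub>R x i + v *\<^sub>R y i"]) simp
qed

text \<open>Because the slope c is common, both inequalities are additive over the summands, and
  each vertex of the result is the sum of the corresponding vertices. Each \<open>P i\<close> is
  sandwiched between its vertices and its truncated simplex, which is how the hulls of the supports
  will be given.\<close>

lemma mink_comb_trunc_simplex:
  fixes P :: "'k option \<Rightarrow> (real ^ ('k::finite) option) set"
  assumes cz: "c \<ge> 0" "\<And>i. z i \<ge> 0" "\<And>i. (c + 1) * z i \<le> T i"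
    and P: "\<And>i. convex (P i)" "\<And>i. P i \<subseteq> trunc_simplex c (T i) (z i)" "\<And>i. 0 \<in> P i"
      "\<And>i j. opt_vec 0 (delta j (T i)) \<in> P i"
      "\<And>i j. opt_vec ((T i - z i) / 2) (delta j (z i)) \<in> P i"
      "\<And>i. opt_vec ((T i - (c + 1) * z i) / 2) (\<lambda>_. 0) \<in> P i"
    and l: "\<And>i. 0 \<le> l $ i"
  shows "mink_comb P l
    = trunc_simplex c (\<Sum>i\<in>UNIV. T i * l $ i) (\<Sum>i\<in>UNIV. z i * l $ i)"
    (is "_ = trunc_simplex c ?T ?z")
proof (intro equalityI)
  show "mink_comb P l \<subseteq> trunc_simplex c ?T ?z"
  proof
    fix p assume "p \<in> mink_comb P l"
    then obtain x where x: "p = (\<Sum>i\<in>UNIV. l $ i *\<^sub>R x i)" "\<And>i. x i \<in> P i"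
      by (auto simp: mink_comb_def)
    have xi: "0 \<le> x i $ j" "2 * x i $ None + tail (x i) \<le> T i"
        "2 * x i $ None - c * tail (x i) \<le> T i - (c + 1) * z i" for i j
      using P(2)[of i] x(2)[of i] by (auto simp: trunc_simplex_def wsimplex_def)
    have tail_p: "tail p = (\<Sum>i\<in>UNIV. l $ i * tail (x i))"
    proof -
      have "tail p = (\<Sum>s\<in>UNIV. \<Sum>i\<in>UNIV. l $ i * x i $ Some s)" by (simp add: x(1))
      also have "\<dots> = (\<Sum>i\<in>UNIV. \<Sum>s\<in>UNIV. l $ i * x i $ Some s)" by (rule sum.swap)
      finally show ?thesis by (simp add: sum_distrib_left)
    qed
    have None_p: "p $ None = (\<Sum>i\<in>UNIV. l $ i * x i $ None)" by (simp add: x(1))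
    have "0 \<le> p $ j" for j using xi(1) l by (simp add: x(1) sum_nonneg)
    moreover have "2 * p $ None + tail p = (\<Sum>i\<in>UNIV. l $ i * (2 * x i $ None + tail (x i)))"
      unfolding tail_p None_p sum_distrib_left sum.distrib[symmetric]
      by (intro sum.cong) (simp_all add: distrib_left sum_distrib_left mult_ac)
    then have "2 * p $ None + tail p \<le> ?T"
      using xi(2) l by (auto intro!: sum_mono mult_left_mono simp: mult.commute[of "T _"])
    moreover have "2 * p $ None - c * tail p
        = (\<Sum>i\<in>UNIV. l $ i * (2 * x i $ None - c * tail (x i)))"
      unfolding tail_p None_p sum_distrib_left sum_subtractf[symmetric]
      by (intro sum.cong refl) (simp add: right_diff_distrib sum_distrib_left mult_ac)
    then have "2 * p $ None - c * tail p \<le> (\<Sum>i\<in>UNIV. l $ i * (T i - (c + 1) * z i))"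
      using xi(3) l by (auto intro!: sum_mono mult_left_mono)
    moreover have "(\<Sum>i\<in>UNIV. l $ i * (T i - (c + 1) * z i)) = ?T - (c + 1) * ?z"
      by (simp add: sum_distrib_left right_diff_distrib sum_subtractf mult_ac)
    ultimately show "p \<in> trunc_simplex c ?T ?z" by (simp add: trunc_simplex_def wsimplex_def)
  qed
  have mem: "(\<Sum>i\<in>UNIV. l $ i *\<^sub>R x i) \<in> mink_comb P l" if "\<And>i. x i \<in> P i" for x
    using that by (auto simp: mink_comb_def)
  show "trunc_simplex c ?T ?z \<subseteq> mink_comb P l"
  proof (rule trunc_simplex_subset_convex)
    show "c \<ge> 0" by fact
    show "?z \<ge> 0" using cz l by (simp add: sum_nonneg)
    show "(c + 1) * ?z \<le> ?T"
      unfolding sum_distrib_left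
      by (rule sum_mono) (use cz(3) l in \<open>simp add: mult_right_mono flip: mult.assoc\<close>)
    show "convex (mink_comb P l)" by (rule convex_mink_comb) (rule P(1))
    show "0 \<in> mink_comb P l" using mem[of "\<lambda>_. 0"] P(3) by simp
    have eq: "(\<Sum>i\<in>UNIV. l $ i *\<^sub>R opt_vec (a i) (b i))
        = opt_vec (\<Sum>i\<in>UNIV. a i * l $ i) (\<lambda>s. \<Sum>i\<in>UNIV. b i s * l $ i)" for a b
      by (intro vec_option_eqI) (simp_all add: mult.commute)
    have delta: "(\<lambda>s. \<Sum>i\<in>UNIV. delta j (r i) s * l $ i) = delta j (\<Sum>i\<in>UNIV. r i * l $ i)"
      for j :: 'k and r
      by (auto simp: delta_def fun_eq_iff)
    show "opt_vec 0 (delta j ?T) \<in> mink_comb P l" for j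
      using mem[of "\<lambda>i. opt_vec 0 (delta j (T i))"] P(4) unfolding eq delta by simp
    have half: "(\<Sum>i\<in>UNIV. (T i - z i) / 2 * l $ i) = (?T - ?z) / 2"
      by (simp add: sum_subtractf sum_divide_distrib diff_divide_distrib left_diff_distrib)
    show "opt_vec ((?T - ?z) / 2) (delta j ?z) \<in> mink_comb P l" for j
      using mem[of "\<lambda>i. opt_vec ((T i - z i) / 2) (delta j (z i))", OF P(5)]
      unfolding eq delta half .
    have half: "(\<Sum>i\<in>UNIV. (T i - (c + 1) * z i) / 2 * l $ i) = (?T - (c + 1) * ?z) / 2"
      unfolding sum_distrib_left sum_subtractf[symmetric] sum_divide_distrib
      by (intro sum.cong refl) (simp add: algebra_simps)
    show "opt_vec ((?T - (c + 1) * ?z) / 2) (\<lambda>_. 0) \<in> mink_comb P l"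
      using mem[of "\<lambda>i. opt_vec ((T i - (c + 1) * z i) / 2) (\<lambda>_. 0)", OF P(6)]
      unfolding eq half by simp
  qed
qed

text \<open>The expansion of q (T_1 l_1 + ... + T_N l_N)^N, where g chooses the variable taken from
  each of the N factors. Summing over choices avoids multinomial coefficients; equal exponents are
  merged by the addition of polynomials.\<close>

definition linear_power :: "real \<Rightarrow> ('v \<Rightarrow> real) \<Rightarrow> (nat ^ 'v::finite) \<Rightarrow>\<^sub>0 real" where
  "linear_power q T = (\<Sum>g\<in>(UNIV :: ('v \<Rightarrow> 'v) set).
     Poly_Mapping.single (\<chi> i. card {j. g j = i}) (q * (\<Prod>j\<in>UNIV. T (g j))))"

lemma eval_linear_power:
  "eval_poly (linear_power q T) (l :: real ^ 'v::finite) = q * (\<Sum>i\<in>UNIV. T i * l $ i) ^ CARD('v)"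
proof -
  have group: "(\<Prod>j\<in>UNIV. l $ g j) = monom_at (\<chi> i. card {j. g j = i}) l" for g :: "'v \<Rightarrow> 'v"
  proof -
    have "(\<Prod>j\<in>UNIV. l $ g j) = (\<Prod>i\<in>UNIV. \<Prod>j\<in>{j \<in> UNIV. g j = i}. l $ g j)"
      by (rule prod.group[symmetric]) auto
    also have "\<dots> = monom_at (\<chi> i. card {j. g j = i}) l"
      unfolding monom_at_def by (intro prod.cong) auto
    finally show ?thesis .
  qed
  have "(\<Sum>i\<in>UNIV. T i * l $ i) ^ CARD('v) = (\<Prod>j\<in>(UNIV :: 'v set). \<Sum>i\<in>UNIV. T i * l $ i)"
    by simp
  also have "\<dots> = (\<Sum>g\<in>PiE UNIV (\<lambda>_. UNIV). \<Prod>j\<in>(UNIV :: 'v set). T (g j) * l $ g j)"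
    by (rule prod_sum_PiE) auto
  also have "PiE UNIV (\<lambda>_. UNIV) = (UNIV :: ('v \<Rightarrow> 'v) set)" by auto
  finally show ?thesis
    by (simp add: linear_power_def eval_poly_sum sum_distrib_left mult.assoc prod.distrib group)
qed

text \<open>A choice g takes every variable exactly once precisely when it is a bijection; there are
  N! of these, and all contribute the same product.\<close>

lemma lookup_linear_power_ones:
  "Poly_Mapping.lookup (linear_power q T) ((\<chi> i. 1) :: nat ^ 'v::finite)
    = q * fact CARD('v) * (\<Prod>i\<in>UNIV. T i)"
proof -
  have ones: "(\<chi> i. card {j. g j = i}) = ((\<chi> i. 1) :: nat ^ 'v) \<longleftrightarrow> bij g" for g :: "'v \<Rightarrow> 'v"
  proof -
    have "(\<chi> i. card {j. g j = i}) = ((\<chi> i. 1) :: nat ^ 'v) \<longleftrightarrow> (\<forall>i. \<exists>!j. g j = i)"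
      by (simp add: vec_eq_iff card_1_singleton_iff Ex1_def set_eq_iff) blast
    then show ?thesis by (simp add: bij_iff)
  qed
  have "Poly_Mapping.lookup (linear_power q T) (\<chi> i. 1)
      = (\<Sum>g\<in>(UNIV :: ('v \<Rightarrow> 'v) set). if bij g then q * (\<Prod>j\<in>UNIV. T (g j)) else 0)"
    by (simp only: linear_power_def lookup_sum lookup_single when_def ones)
  also have "\<dots> = (\<Sum>g\<in>{g :: 'v \<Rightarrow> 'v. bij g}. q * (\<Prod>j\<in>UNIV. T (g j)))"
    by (simp add: sum.If_cases)
  also have "\<dots> = (\<Sum>g\<in>{g :: 'v \<Rightarrow> 'v. bij g}. q * (\<Prod>j\<in>UNIV. T j))"
    by (intro sum.cong refl arg_cong2[where f = "(*)"] prod.reindex_bij_betw) simp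
  also have "{g :: 'v \<Rightarrow> 'v. bij g} = {p. p permutes UNIV}"
    by (simp add: permutes_univ bij_iff)
  finally show ?thesis
    by (simp add: card_permutations[OF refl finite])
qed

text \<open>The factorial of \<open>lookup_linear_power_ones\<close> cancels the one in the simplex
  volume; the 2 that is left is the weight of \<rho>.\<close>

lemma MV_trunc_simplex:
  fixes B :: "'k option \<Rightarrow> (int ^ ('k::finite) option) set"
  assumes cz: "c \<ge> 0" "\<And>i. z i \<ge> 0" "\<And>i. (c + 1) * z i \<le> T i"
    and B: "\<And>i. hull_int (B i) \<subseteq> trunc_simplex c (T i) (z i)" "\<And>i. 0 \<in> hull_int (B i)"
      "\<And>i j. opt_vec 0 (delta j (T i)) \<in> hull_int (B i)"
      "\<And>i j. opt_vec ((T i - z i) / 2) (delta j (z i)) \<in> hull_int (B i)"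
      "\<And>i. opt_vec ((T i - (c + 1) * z i) / 2) (\<lambda>_. 0) \<in> hull_int (B i)"
  shows "MV B = ((\<Prod>i\<in>UNIV. T i) - (c + 1) * (\<Prod>i\<in>UNIV. z i)) / 2"
proof -
  let ?q = "1 / (2 * fact CARD('k option)) :: real"
  let ?Q = "linear_power ?q T + linear_power (- ((c + 1) / (2 * fact CARD('k option)))) z"
  let ?P = "\<lambda>i. hull_int (B i)"
  have coeff: "a / (2 * fact CARD('k option)) * fact CARD('k option) = a / 2" for a :: real
    by simp
  have alg: "(a - (c + 1) * b) / d = 1 / d * a + - ((c + 1) / d) * b" for a b d :: real
    by (simp add: diff_divide_distrib add_divide_distrib algebra_simps)
  have vol: "measure lebesgue (mink_comb ?P l) = eval_poly ?Q l" if l: "\<forall>i. 0 \<le> l $ i" for l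
  proof -
    let ?T = "\<Sum>i\<in>UNIV. T i * l $ i" and ?z = "\<Sum>i\<in>UNIV. z i * l $ i"
    have "mink_comb ?P l = trunc_simplex c ?T ?z"
      by (rule mink_comb_trunc_simplex[OF cz _ B])
        (use l in \<open>auto simp: hull_int_def convex_convex_hull\<close>)
    moreover have "?z \<ge> 0" using cz l by (simp add: sum_nonneg)
    moreover have "(c + 1) * ?z \<le> ?T"
      unfolding sum_distrib_left
      by (rule sum_mono) (use cz(3) l in \<open>simp add: mult_right_mono flip: mult.assoc\<close>)
    ultimately show ?thesis
      using measure_trunc_simplex[OF cz(1), where ?'k = 'k]
      by (simp only: eval_poly_add eval_linear_power alg)
  qed
  have "volume_poly ?P = ?Q"
    unfolding volume_poly_def
  proof (rule the_equality)
    show "\<forall>l. (\<forall>i. 0 \<le> l $ i) \<longrightarrow> measure lebesgue (mink_comb ?P l) = eval_poly ?Q l"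
      using vol by blast
    fix Q assume Q: "\<forall>l. (\<forall>i. 0 \<le> l $ i) \<longrightarrow> measure lebesgue (mink_comb ?P l) = eval_poly Q l"
    show "Q = ?Q"
    proof (rule eval_poly_unique)
      fix l :: "real ^ 'k option" assume "\<And>i. 0 < l $ i"
      then have "\<forall>i. 0 \<le> l $ i" by (simp add: less_imp_le)
      with vol Q show "eval_poly Q l = eval_poly ?Q l" by metis
    qed
  qed
  then show ?thesis
    by (simp only: MV_def lookup_add lookup_linear_power_ones) (simp add: coeff)
qed

section \<open>The averaged polynomials and their supports\<close>

definition trig_moment :: "nat \<Rightarrow> nat \<Rightarrow> real" where
  "trig_moment i j = integral {0..2 * pi} (\<lambda>\<theta>. cos \<theta> ^ i * sin \<theta> ^ j)"

lemma has_integral_trig_moment: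
  "((\<lambda>\<theta>. cos \<theta> ^ i * sin \<theta> ^ j) has_integral trig_moment i j) {0..2 * pi}"
  unfolding trig_moment_def
  by (intro integrable_integral integrable_continuous_interval continuous_intros)

lemma trig_moment_antiderivative:
  assumes "\<And>\<theta>. (G has_real_derivative g \<theta>) (at \<theta>)" "(g has_integral I) {0..2 * pi}"
  shows "I = G (2 * pi) - G 0"
proof -
  have "(g has_integral (G (2 * pi) - G 0)) {0..2 * pi}"
    using assms(1) by (intro fundamental_theorem_of_calculus)
      (auto simp: has_real_derivative_iff_has_vector_derivative[symmetric] intro: DERIV_subset)
  with assms(2) show ?thesis by (rule has_integral_unique)
qed

lemma trig_moment_one_right: "trig_moment i 1 = 0"
proof -
  have "((\<lambda>\<theta>. - (cos \<theta> ^ Suc i) / Suc i) has_real_derivative cos \<theta> ^ i * sin \<theta> ^ 1) (at \<theta>)" for \<theta>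
    by (rule DERIV_cong[OF DERIV_cdivide[OF DERIV_minus[OF DERIV_power_Suc[OF DERIV_cos]]]]) simp
  from trig_moment_antiderivative[OF this has_integral_trig_moment] show ?thesis by simp
qed

lemma trig_moment_one_left: "trig_moment 1 j = 0"
proof -
  have "((\<lambda>\<theta>. sin \<theta> ^ Suc j / Suc j) has_real_derivative cos \<theta> ^ 1 * sin \<theta> ^ j) (at \<theta>)" for \<theta>
    by (rule DERIV_cong[OF DERIV_cdivide[OF DERIV_power_Suc[OF DERIV_sin]]]) simp
  from trig_moment_antiderivative[OF this has_integral_trig_moment] show ?thesis by simp
qed

lemma trig_moment_pythagoras: "trig_moment (i + 2) j + trig_moment i (j + 2) = trig_moment i j"
proof -
  have "((\<lambda>\<theta>. cos \<theta> ^ (i + 2) * sin \<theta> ^ j + cos \<theta> ^ i * sin \<theta> ^ (j + 2)) has_integral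
      trig_moment (i + 2) j + trig_moment i (j + 2)) {0..2 * pi}"
    by (intro has_integral_add has_integral_trig_moment)
  moreover have "cos \<theta> ^ (i + 2) * sin \<theta> ^ j + cos \<theta> ^ i * sin \<theta> ^ (j + 2) = cos \<theta> ^ i * sin \<theta> ^ j"
    for \<theta> :: real
  proof -
    have "cos \<theta> ^ (i + 2) * sin \<theta> ^ j + cos \<theta> ^ i * sin \<theta> ^ (j + 2)
        = cos \<theta> ^ i * sin \<theta> ^ j * ((cos \<theta>)\<^sup>2 + (sin \<theta>)\<^sup>2)"
      by (simp only: power_add distrib_left mult_ac)
    then show ?thesis by simp
  qed
  ultimately show ?thesis using has_integral_trig_moment[of i j] by (simp add: has_integral_unique)
qed

text \<open>Periodic antiderivatives settle exponent 1; the Pythagorean recursion lowers any odd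
  exponent to 1 by steps of two.\<close>

lemma trig_moment_odd:
  assumes "odd i \<or> odd j"
  shows "trig_moment i j = 0"
proof -
  have right: "trig_moment i (2 * l + 1) = 0" for i l
  proof (induction l arbitrary: i)
    case (Suc l)
    then show ?case using trig_moment_pythagoras[of i "2 * l + 1"] by simp
  qed (use trig_moment_one_right in simp)
  have left: "trig_moment (2 * l + 1) j = 0" for j l
  proof (induction l arbitrary: j)
    case (Suc l)
    then show ?case using trig_moment_pythagoras[of "2 * l + 1" j] by simp
  qed (use trig_moment_one_left in simp)
  from assms left right show ?thesis by (auto elim!: oddE)
qed

text \<open>Integrating the derivative of the periodic function cos^(2l+1) sin gives (2l+2) M(l+1) =
  (2l+1) M(l) for the moments M(l) of cos^(2l). These are the moments on which the witnesses for the
  supports rely.\<close>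

lemma trig_moment_pos: "trig_moment (2 * l) 0 > 0"
proof (induction l)
  case 0
  show ?case by (simp add: trig_moment_def)
next
  case (Suc l)
  have "((\<lambda>\<theta>. cos \<theta> ^ Suc (2 * l) * sin \<theta>) has_real_derivative
      cos \<theta> ^ (2 * l + 2) * sin \<theta> ^ 0 - (2 * l + 1) * (cos \<theta> ^ (2 * l) * sin \<theta> ^ 2)) (at \<theta>)" for \<theta>
    by (rule DERIV_cong[OF DERIV_mult[OF DERIV_power_Suc[OF DERIV_cos] DERIV_sin]])
      (simp add: power2_eq_square algebra_simps)
  from trig_moment_antiderivative[OF this
      has_integral_diff[OF has_integral_trig_moment
        has_integral_mult_right[OF has_integral_trig_moment, of "2 * l + 1"]]]
  have "trig_moment (2 * l + 2) 0 = (2 * l + 1) * trig_moment (2 * l) 2" by simp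
  moreover have "trig_moment (2 * l) 2 = trig_moment (2 * l) 0 - trig_moment (2 * l + 2) 0"
    using trig_moment_pythagoras[of "2 * l" 0] unfolding add_0 by linarith
  ultimately have "(2 * l + 2) * trig_moment (2 * l + 2) 0 = (2 * l + 1) * trig_moment (2 * l) 0"
    by (simp add: algebra_simps)
  moreover have "(2 * l + 1) * trig_moment (2 * l) 0 > 0" using Suc by simp
  ultimately have "0 < (2 * l + 2) * trig_moment (2 * l + 2) 0" by simp
  then show ?case by (simp add: zero_less_mult_iff)
qed

section \<open>The averaged polynomials\<close>

lemma finite_multi_indices: "finite (multi_indices m :: (nat \<times> nat \<times> (nat ^ 'k::finite)) set)"
proof (rule finite_subset)
  show "multi_indices m \<subseteq> {..m} \<times> {..m} \<times> {\<beta> :: nat ^ 'k. (\<Sum>s\<in>UNIV. \<beta> $ s) \<le> m}"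
    by (auto simp: multi_indices_def)
qed (intro finite_cartesian_product finite_atMost finite_bounded_exponents)

text \<open>The monomial \<open>x\<^sub>1^i1 x\<^sub>2^i2\<close> contributes to the first component only if \<open>i1 + i2\<close> is odd;
  otherwise the truncated exponent of \<open>\<rho>\<close> comes with coefficient 0.\<close>

fun averaged_poly :: "('k::finite) params \<Rightarrow> nat \<Rightarrow> 'k option \<Rightarrow> (nat ^ 'k option) \<Rightarrow>\<^sub>0 real" where
  "averaged_poly q m None = Poly_Mapping.single 0 (2 * pi * par_a q) +
     (\<Sum>(i1, i2, \<beta>)\<in>multi_indices m. Poly_Mapping.single (exp_pair ((i1 + i2 - 1) div 2) \<beta>)
        (par_p1 q i1 i2 \<beta> * trig_moment (i1 + 1) i2 + par_p2 q i1 i2 \<beta> * trig_moment i1 (i2 + 1)))"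
| "averaged_poly q m (Some s) = Poly_Mapping.single (axis (Some s) 1) (2 * pi * par_c q s) +
     (\<Sum>(i1, i2, \<beta>)\<in>multi_indices m. Poly_Mapping.single (exp_pair ((i1 + i2) div 2) \<beta>)
        (par_ps q s i1 i2 \<beta> * trig_moment i1 i2))"

declare averaged_poly.simps [simp del]

lemma lookup_averaged_poly:
  "Poly_Mapping.lookup (averaged_poly q m None) \<alpha> = (if \<alpha> = 0 then 2 * pi * par_a q else 0) +
     (\<Sum>(i1, i2, \<beta>)\<in>multi_indices m. if exp_pair ((i1 + i2 - 1) div 2) \<beta> = \<alpha> then
        par_p1 q i1 i2 \<beta> * trig_moment (i1 + 1) i2 + par_p2 q i1 i2 \<beta> * trig_moment i1 (i2 + 1) else 0)"
  "Poly_Mapping.lookup (averaged_poly q m (Some s)) \<alpha>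
     = (if \<alpha> = axis (Some s) 1 then 2 * pi * par_c q s else 0) +
     (\<Sum>(i1, i2, \<beta>)\<in>multi_indices m. if exp_pair ((i1 + i2) div 2) \<beta> = \<alpha> then
        par_ps q s i1 i2 \<beta> * trig_moment i1 i2 else 0)"
  by (auto simp: averaged_poly.simps lookup_add lookup_sum lookup_single when_def split_def
      intro!: sum.cong)

lemma monom_at_exp_pair:
  "monom_at (exp_pair a \<beta>) (to_rho \<eta>) = (\<eta> $ None) ^ (2 * a) * (\<Prod>s\<in>UNIV. (\<eta> $ Some s) ^ (\<beta> $ s))"
  by (simp add: monom_at_def prod_UNIV_option exp_pair_def to_rho_def power_mult)

lemma polar_monom_eq:
  "polar_monom i1 i2 \<beta> \<theta> \<eta> = (\<eta> $ None) ^ (i1 + i2) * (\<Prod>s\<in>UNIV. (\<eta> $ Some s) ^ (\<beta> $ s))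
     * (cos \<theta> ^ i1 * sin \<theta> ^ i2)"
  by (simp add: polar_monom_def power_mult_distrib power_add mult_ac)

lemma f1_eq_averaged_poly:
  "f1 q m \<eta> $ s = (case s of None \<Rightarrow> \<eta> $ None / par_b q | Some _ \<Rightarrow> 1 / par_b q)
     * eval_poly (averaged_poly q m s) (to_rho \<eta>)"
proof -
  let ?X = "\<lambda>\<beta>. \<Prod>s\<in>UNIV. (\<eta> $ Some s) ^ (\<beta> $ s)"
  have const: "((\<lambda>\<theta>. r) has_integral 2 * pi * r) {0..2 * pi}" for r :: real
    using has_integral_const_real[of r 0 "2 * pi"] by simp
  show ?thesis
  proof (cases s)
    case None
    let ?c = "\<lambda>i1 i2 \<beta>. par_p1 q i1 i2 \<beta> * trig_moment (i1 + 1) i2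
        + par_p2 q i1 i2 \<beta> * trig_moment i1 (i2 + 1)"
    have "((\<lambda>\<theta>. (par_p1 q i1 i2 \<beta> * cos \<theta> + par_p2 q i1 i2 \<beta> * sin \<theta>) * polar_monom i1 i2 \<beta> \<theta> \<eta>)
        has_integral (\<eta> $ None) ^ (i1 + i2) * ?X \<beta> * ?c i1 i2 \<beta>) {0..2 * pi}" for i1 i2 \<beta>
    proof -
      have "((\<lambda>\<theta>. (\<eta> $ None) ^ (i1 + i2) * ?X \<beta> *
          (par_p1 q i1 i2 \<beta> * (cos \<theta> ^ (i1 + 1) * sin \<theta> ^ i2)
            + par_p2 q i1 i2 \<beta> * (cos \<theta> ^ i1 * sin \<theta> ^ (i2 + 1))))
        has_integral (\<eta> $ None) ^ (i1 + i2) * ?X \<beta> * ?c i1 i2 \<beta>) {0..2 * pi}"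
        by (intro has_integral_mult_right has_integral_add has_integral_trig_moment)
      then show ?thesis by (rule has_integral_eq[rotated]) (simp add: polar_monom_eq algebra_simps)
    qed
    then have "((\<lambda>\<theta>. F q m None \<theta> \<eta>) has_integral 1 / par_b q * (2 * pi * (par_a q * \<eta> $ None)
        + (\<Sum>(i1, i2, \<beta>)\<in>multi_indices m. (\<eta> $ None) ^ (i1 + i2) * ?X \<beta> * ?c i1 i2 \<beta>))) {0..2 * pi}"
      unfolding F.simps
      by (intro has_integral_mult_right has_integral_add const has_integral_sum finite_multi_indices)
        auto
    then have "f1 q m \<eta> $ None = 1 / par_b q * (2 * pi * (par_a q * \<eta> $ None)
        + (\<Sum>(i1, i2, \<beta>)\<in>multi_indices m. (\<eta> $ None) ^ (i1 + i2) * ?X \<beta> * ?c i1 i2 \<beta>))"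
      by (simp only: f1_def vec_lambda_beta integral_unique)
    also have "(\<Sum>(i1, i2, \<beta>)\<in>multi_indices m. (\<eta> $ None) ^ (i1 + i2) * ?X \<beta> * ?c i1 i2 \<beta>)
        = \<eta> $ None * (\<Sum>(i1, i2, \<beta>)\<in>multi_indices m.
            ?c i1 i2 \<beta> * monom_at (exp_pair ((i1 + i2 - 1) div 2) \<beta>) (to_rho \<eta>))"
      unfolding sum_distrib_left
    proof (intro sum.cong refl, clarify)
      fix i1 i2 \<beta>
      show "(\<eta> $ None) ^ (i1 + i2) * ?X \<beta> * ?c i1 i2 \<beta>
          = \<eta> $ None * (?c i1 i2 \<beta> * monom_at (exp_pair ((i1 + i2 - 1) div 2) \<beta>) (to_rho \<eta>))"
      proof (cases "odd (i1 + i2)")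
        case True
        then have "i1 + i2 = Suc (2 * ((i1 + i2 - 1) div 2))" by (auto elim!: oddE)
        then have "(\<eta> $ None) ^ (i1 + i2) = \<eta> $ None * (\<eta> $ None) ^ (2 * ((i1 + i2 - 1) div 2))"
          by (metis power_Suc)
        then show ?thesis unfolding monom_at_exp_pair by simp
      next
        case False
        then have "trig_moment (i1 + 1) i2 = 0" "trig_moment i1 (i2 + 1) = 0"
          by (auto intro!: trig_moment_odd)
        then show ?thesis by simp
      qed
    qed
    finally show ?thesis unfolding None
      by (simp add: averaged_poly.simps eval_poly_add eval_poly_sum split_def distrib_left add_divide_distrib)
  next
    case (Some j)
    have "((\<lambda>\<theta>. par_ps q j i1 i2 \<beta> * polar_monom i1 i2 \<beta> \<theta> \<eta>)
        has_integral (\<eta> $ None) ^ (i1 + i2) * ?X \<beta> * (par_ps q j i1 i2 \<beta> * trig_moment i1 i2)) {0..2 * pi}"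
      for i1 i2 \<beta>
    proof -
      have "((\<lambda>\<theta>. (\<eta> $ None) ^ (i1 + i2) * ?X \<beta> *
          (par_ps q j i1 i2 \<beta> * (cos \<theta> ^ i1 * sin \<theta> ^ i2)))
        has_integral (\<eta> $ None) ^ (i1 + i2) * ?X \<beta> * (par_ps q j i1 i2 \<beta> * trig_moment i1 i2)) {0..2 * pi}"
        by (intro has_integral_mult_right has_integral_trig_moment)
      then show ?thesis by (rule has_integral_eq[rotated]) (simp add: polar_monom_eq algebra_simps)
    qed
    then have "((\<lambda>\<theta>. F q m (Some j) \<theta> \<eta>) has_integral 1 / par_b q * (2 * pi * (par_c q j * \<eta> $ Some j)
        + (\<Sum>(i1, i2, \<beta>)\<in>multi_indices m.
            (\<eta> $ None) ^ (i1 + i2) * ?X \<beta> * (par_ps q j i1 i2 \<beta> * trig_moment i1 i2)))) {0..2 * pi}"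
      unfolding F.simps
      by (intro has_integral_mult_right has_integral_add const has_integral_sum finite_multi_indices)
        auto
    then have "f1 q m \<eta> $ Some j = 1 / par_b q * (2 * pi * (par_c q j * \<eta> $ Some j)
        + (\<Sum>(i1, i2, \<beta>)\<in>multi_indices m.
            (\<eta> $ None) ^ (i1 + i2) * ?X \<beta> * (par_ps q j i1 i2 \<beta> * trig_moment i1 i2)))"
      by (simp only: f1_def vec_lambda_beta integral_unique)
    also have "(\<Sum>(i1, i2, \<beta>)\<in>multi_indices m.
            (\<eta> $ None) ^ (i1 + i2) * ?X \<beta> * (par_ps q j i1 i2 \<beta> * trig_moment i1 i2))
        = (\<Sum>(i1, i2, \<beta>)\<in>multi_indices m. par_ps q j i1 i2 \<beta> * trig_moment i1 i2
            * monom_at (exp_pair ((i1 + i2) div 2) \<beta>) (to_rho \<eta>))"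
    proof (intro sum.cong refl, clarify)
      fix i1 i2 \<beta>
      show "(\<eta> $ None) ^ (i1 + i2) * ?X \<beta> * (par_ps q j i1 i2 \<beta> * trig_moment i1 i2)
          = par_ps q j i1 i2 \<beta> * trig_moment i1 i2
            * monom_at (exp_pair ((i1 + i2) div 2) \<beta>) (to_rho \<eta>)"
      proof (cases "odd (i1 + i2)")
        case True
        then have "trig_moment i1 i2 = 0" by (auto intro!: trig_moment_odd)
        then show ?thesis by simp
      next
        case False
        then have "2 * ((i1 + i2) div 2) = i1 + i2" by simp
        then show ?thesis unfolding monom_at_exp_pair by simp
      qed
    qed
    finally show ?thesis unfolding Some
      by (simp add: averaged_poly.simps eval_poly_add eval_poly_sum split_def distrib_left add_divide_distrib to_rho_def)
  qed
qed

lemma fbar_eq_averaged_poly: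
  assumes "par_b q \<noteq> 0"
  shows "fbar q m s = averaged_poly q m s"
  unfolding fbar_def
proof (rule the_equality)
  show "\<forall>\<eta>. \<eta> $ None > 0 \<longrightarrow> f1 q m \<eta> $ s =
      (case s of None \<Rightarrow> \<eta> $ None / par_b q | Some _ \<Rightarrow> 1 / par_b q)
        * eval_poly (averaged_poly q m s) (to_rho \<eta>)"
    using f1_eq_averaged_poly by blast
next
  fix P
  assume P: "\<forall>\<eta>. \<eta> $ None > 0 \<longrightarrow> f1 q m \<eta> $ s =
      (case s of None \<Rightarrow> \<eta> $ None / par_b q | Some _ \<Rightarrow> 1 / par_b q) * eval_poly P (to_rho \<eta>)"
  show "P = averaged_poly q m s"
  proof (rule eval_poly_unique)
    fix x :: "real ^ 'a option" assume x: "\<And>i. 0 < x $ i"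
    \<comment> \<open>A preimage of x under \<open>to_rho\<close> with R > 0, available since the
      \<rho> coordinate of x is positive.\<close>
    define \<eta> where "\<eta> = opt_vec (sqrt (x $ None)) (\<lambda>s. x $ Some s)"
    have "\<eta> $ None > 0" using x by (simp add: \<eta>_def)
    moreover have "to_rho \<eta> = x"
      by (intro vec_option_eqI) (use x[of None] in \<open>auto simp: to_rho_def \<eta>_def\<close>)
    ultimately have
      "(case s of None \<Rightarrow> \<eta> $ None / par_b q | Some _ \<Rightarrow> 1 / par_b q) * eval_poly P x
        = (case s of None \<Rightarrow> \<eta> $ None / par_b q | Some _ \<Rightarrow> 1 / par_b q)
          * eval_poly (averaged_poly q m s) x"
      using P f1_eq_averaged_poly[of q m \<eta> s] by metis
    moreover have "(case s of None \<Rightarrow> \<eta> $ None / par_b q | Some _ \<Rightarrow> 1 / par_b q) \<noteq> 0"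
      using assms \<open>\<eta> $ None > 0\<close> by (auto split: option.split)
    ultimately show "eval_poly P x = eval_poly (averaged_poly q m s) x" by simp
  qed
qed

section \<open>Weights and generic supports\<close>

abbreviation weight :: "nat ^ ('k::finite) option \<Rightarrow> nat" where
  "weight \<alpha> \<equiv> 2 * \<alpha> $ None + tail \<alpha>"

lemma exp_pair_nth [simp]: "exp_pair a \<beta> $ None = a" "exp_pair a \<beta> $ Some s = \<beta> $ s"
  by (simp_all add: exp_pair_def)

text \<open>The moments kill every term with i1 + i2 even. For i1 + i2 odd the division by 2 is
  exact, and splitting off the factor R lowers the weight from m to m - 1.\<close>

lemma keys_averaged_poly_None:
  assumes "Poly_Mapping.lookup (averaged_poly q m None) \<alpha> \<noteq> 0" "\<alpha> \<noteq> 0"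
  shows "weight \<alpha> = m - 1"
proof (rule ccontr)
  assume w: "weight \<alpha> \<noteq> m - 1"
  have "par_p1 q i1 i2 \<beta> * trig_moment (i1 + 1) i2 + par_p2 q i1 i2 \<beta> * trig_moment i1 (i2 + 1) = 0"
    if "(i1, i2, \<beta>) \<in> multi_indices m" "exp_pair ((i1 + i2 - 1) div 2) \<beta> = \<alpha>" for i1 i2 \<beta>
  proof -
    have "even (i1 + i2)"
    proof (rule ccontr)
      assume "odd (i1 + i2)"
      then have "2 * ((i1 + i2 - 1) div 2) = i1 + i2 - 1" "i1 + i2 \<ge> 1" by (auto elim!: oddE)
      with that w show False by (auto simp: multi_indices_def)
    qed
    then have "trig_moment (i1 + 1) i2 = 0" "trig_moment i1 (i2 + 1) = 0"
      by (auto intro!: trig_moment_odd)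
    then show ?thesis by simp
  qed
  then have "Poly_Mapping.lookup (averaged_poly q m None) \<alpha> = 0"
    unfolding lookup_averaged_poly using assms(2) by (auto intro!: sum.neutral)
  with assms(1) show False by simp
qed

lemma keys_averaged_poly_Some:
  assumes "Poly_Mapping.lookup (averaged_poly q m (Some s)) \<alpha> \<noteq> 0" "\<alpha> \<noteq> axis (Some s) 1"
  shows "weight \<alpha> = m"
proof (rule ccontr)
  assume w: "weight \<alpha> \<noteq> m"
  have "par_ps q s i1 i2 \<beta> * trig_moment i1 i2 = 0"
    if "(i1, i2, \<beta>) \<in> multi_indices m" "exp_pair ((i1 + i2) div 2) \<beta> = \<alpha>" for i1 i2 \<beta>
  proof -
    have "odd (i1 + i2)"
    proof (rule ccontr)
      assume "\<not> odd (i1 + i2)"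
      then have "2 * ((i1 + i2) div 2) = i1 + i2" by simp
      with that w show False by (auto simp: multi_indices_def)
    qed
    then have "trig_moment i1 i2 = 0" by (auto intro!: trig_moment_odd)
    then show ?thesis by simp
  qed
  then have "Poly_Mapping.lookup (averaged_poly q m (Some s)) \<alpha> = 0"
    unfolding lookup_averaged_poly using assms(2) by (auto intro!: sum.neutral)
  with assms(1) show False by simp
qed

lemma supp_gen_None:
  assumes "m \<ge> 2"
  shows "supp_gen m (None :: ('k::finite) option) = {0} \<union> {\<alpha>. weight \<alpha> = m - 1}"
proof (intro equalityI subsetI)
  fix \<alpha> :: "nat ^ 'k option" assume "\<alpha> \<in> supp_gen m None"
  then obtain q :: "'k params" where "par_b q \<noteq> 0" "Poly_Mapping.lookup (fbar q m None) \<alpha> \<noteq> 0"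
    by (auto simp: supp_gen_def)
  then show "\<alpha> \<in> {0} \<union> {\<alpha>. weight \<alpha> = m - 1}"
    using keys_averaged_poly_None[of q m \<alpha>] fbar_eq_averaged_poly[of q m None] by auto
next
  fix \<alpha> :: "nat ^ 'k option" assume \<alpha>: "\<alpha> \<in> {0} \<union> {\<alpha>. weight \<alpha> = m - 1}"
  define \<beta> where "\<beta> = (\<chi> s. \<alpha> $ Some s)"
  \<comment> \<open>One nonzero parameter is enough: \<open>par_a\<close> for the exponent 0,
    otherwise the coefficient of x_1^(2a+1) times the X-monomial in the first equation. The factor
    cos \<theta> makes the power of the cosine even, so its moment is positive, and no other term
    can cancel it.\<close>
  let ?x = "(2 * \<alpha> $ None + 1, 0 :: nat, \<beta>)"
  define q :: "'k params" where "q = \<lparr>par_a = of_bool (\<alpha> = 0), par_b = 1, par_c = \<lambda>_. 0,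
    par_p1 = \<lambda>i1 i2 \<beta>'. of_bool (\<alpha> \<noteq> 0 \<and> (i1, i2, \<beta>') = ?x), par_p2 = \<lambda>_ _ _. 0, par_ps = \<lambda>_ _ _ _. 0\<rparr>"
  have "Poly_Mapping.lookup (averaged_poly q m None) \<alpha> \<noteq> 0"
  proof (cases "\<alpha> = 0")
    case True
    then show ?thesis
      by (simp add: q_def lookup_averaged_poly split_def cong: if_cong)
  next
    case False
    with \<alpha> have w: "weight \<alpha> = m - 1" by simp
    have x: "?x \<in> multi_indices m" using w assms by (simp add: multi_indices_def \<beta>_def)
    have "Poly_Mapping.lookup (averaged_poly q m None) \<alpha>
        = (\<Sum>y\<in>multi_indices m. if y = ?x then trig_moment (2 * (\<alpha> $ None + 1)) 0 else 0)"
      using False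
      by (auto simp: q_def lookup_averaged_poly \<beta>_def intro!: sum.cong vec_option_eqI)
    also have "\<dots> = trig_moment (2 * (\<alpha> $ None + 1)) 0"
      by (simp only: sum.delta[OF finite_multi_indices] x if_True)
    finally show ?thesis using trig_moment_pos[of "\<alpha> $ None + 1"] by simp
  qed
  moreover have "par_b q \<noteq> 0" by (simp add: q_def)
  ultimately show "\<alpha> \<in> supp_gen m None"
    unfolding supp_gen_def using fbar_eq_averaged_poly[of q m None] by auto
qed

lemma supp_gen_Some:
  fixes s :: "'k::finite"
  assumes "m \<ge> 2"
  shows "supp_gen m (Some s) = {axis (Some s) 1} \<union> {\<alpha>. weight \<alpha> = m}"
proof (intro equalityI subsetI)
  fix \<alpha> :: "nat ^ 'k option" assume "\<alpha> \<in> supp_gen m (Some s)"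
  then obtain q :: "'k params" where "par_b q \<noteq> 0" "Poly_Mapping.lookup (fbar q m (Some s)) \<alpha> \<noteq> 0"
    by (auto simp: supp_gen_def)
  then show "\<alpha> \<in> {axis (Some s) 1} \<union> {\<alpha>. weight \<alpha> = m}"
    using keys_averaged_poly_Some[of q m s \<alpha>] fbar_eq_averaged_poly[of q m "Some s"] by auto
next
  fix \<alpha> :: "nat ^ 'k option" assume \<alpha>: "\<alpha> \<in> {axis (Some s) 1} \<union> {\<alpha>. weight \<alpha> = m}"
  let ?a = "\<alpha> = axis (Some s) 1"
  define \<beta> where "\<beta> = (\<chi> s. \<alpha> $ Some s)"
  \<comment> \<open>A single parameter again; here the power x_1^(2a) is even by itself.\<close>
  let ?x = "(2 * \<alpha> $ None, 0 :: nat, \<beta>)"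
  define q :: "'k params" where "q = \<lparr>par_a = 0, par_b = 1, par_c = \<lambda>_. of_bool ?a,
    par_p1 = \<lambda>_ _ _. 0, par_p2 = \<lambda>_ _ _. 0, par_ps = \<lambda>_ i1 i2 \<beta>'. of_bool (\<not> ?a \<and> (i1, i2, \<beta>') = ?x)\<rparr>"
  have "Poly_Mapping.lookup (averaged_poly q m (Some s)) \<alpha> \<noteq> 0"
  proof (cases ?a)
    case True
    then show ?thesis
      by (simp add: q_def lookup_averaged_poly split_def cong: if_cong)
  next
    case False
    with \<alpha> have w: "weight \<alpha> = m" by simp
    have x: "?x \<in> multi_indices m" using w by (simp add: multi_indices_def \<beta>_def)
    have "Poly_Mapping.lookup (averaged_poly q m (Some s)) \<alpha>
        = (\<Sum>y\<in>multi_indices m. if y = ?x then trig_moment (2 * \<alpha> $ None) 0 else 0)"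
      using False
      by (auto simp: q_def lookup_averaged_poly \<beta>_def intro!: sum.cong vec_option_eqI)
    also have "\<dots> = trig_moment (2 * \<alpha> $ None) 0"
      by (simp only: sum.delta[OF finite_multi_indices] x if_True)
    finally show ?thesis using trig_moment_pos[of "\<alpha> $ None"] by simp
  qed
  moreover have "par_b q \<noteq> 0" by (simp add: q_def)
  ultimately show "\<alpha> \<in> supp_gen m (Some s)"
    unfolding supp_gen_def using fbar_eq_averaged_poly[of q m "Some s"] by auto
qed

section \<open>Weight levels in terms of index lists\<close>

lemma sum_e_vec: "(\<Sum>s\<in>UNIV. e_vec js $ s) = length (js :: ('k::finite) list)"
proof (induction js)
  case (Cons j js)
  have "e_vec (j # js) $ s = e_vec js $ s + (if s = j then 1 else 0)" for s
    by (simp add: e_vec_def)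
  with Cons show ?case by (simp add: sum.distrib)
qed (simp add: e_vec_def)

lemma ex_e_vec:
  fixes \<beta> :: "nat ^ ('k::finite)"
  obtains js where "e_vec js = \<beta>"
proof -
  have "\<exists>js. e_vec js = \<beta>"
  proof (induction "\<Sum>s\<in>UNIV. \<beta> $ s" arbitrary: \<beta>)
    case 0
    then have "e_vec [] = \<beta>" by (simp add: e_vec_def vec_eq_iff)
    then show ?case by blast
  next
    case (Suc n)
    then obtain j where j: "\<beta> $ j > 0" by (metis gr0I sum.neutral nat.distinct(1))
    have eq: "\<beta> = (\<beta> - axis j 1) + axis j 1" using j by (auto simp: vec_eq_iff axis_def)
    have "(\<Sum>s\<in>UNIV. \<beta> $ s) = (\<Sum>s\<in>UNIV. (\<beta> - axis j 1) $ s) + 1"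
      by (subst eq) (simp add: sum.distrib axis_def)
    then have "n = (\<Sum>s\<in>UNIV. (\<beta> - axis j 1) $ s)" using Suc.hyps(2) by simp
    from Suc.hyps(1)[OF this] obtain js where js: "e_vec js = \<beta> - axis j 1" by blast
    have "e_vec (j # js) = e_vec js + axis j 1" by (auto simp: e_vec_def vec_eq_iff axis_def)
    then have "e_vec (j # js) = \<beta>" using js eq by simp
    then show ?case by blast
  qed
  then show thesis using that by blast
qed

lemma weight_eq_iff:
  "weight \<alpha> = d \<longleftrightarrow> (\<exists>a js. \<alpha> = exp_pair a (e_vec js) \<and> 2 * a + length js = d)"
proof
  assume w: "weight \<alpha> = d"
  obtain js where js: "e_vec js = (\<chi> s. \<alpha> $ Some s)" by (rule ex_e_vec)
  have "\<alpha> = exp_pair (\<alpha> $ None) (e_vec js)" by (intro vec_option_eqI) (simp_all add: js)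
  moreover have "length js = tail \<alpha>" using sum_e_vec[of js] by (simp add: js)
  ultimately show "\<exists>a js. \<alpha> = exp_pair a (e_vec js) \<and> 2 * a + length js = d" using w by metis
qed (auto simp: sum_e_vec)

text \<open>The reindexing is t = h - a, and t starts at 1 because an odd weight leaves at least one
  index.\<close>

lemma weight_odd_set:
  assumes "h \<ge> 1"
  shows "{\<alpha> :: nat ^ ('k::finite) option. weight \<alpha> = 2 * h - 1}
    = (\<Union>t\<in>{1..h}. {exp_pair (h - t) (e_vec js) | js. length js = 2 * t - 1})" (is "?L = ?R")
proof (intro equalityI subsetI)
  fix \<alpha> :: "nat ^ 'k option" assume "\<alpha> \<in> ?L"
  then obtain a js where \<alpha>: "\<alpha> = exp_pair a (e_vec js)" "2 * a + length js = 2 * h - 1"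
    by (auto simp: weight_eq_iff)
  then have t: "h - a \<in> {1..h}" "length js = 2 * (h - a) - 1" "h - (h - a) = a" using assms by auto
  show "\<alpha> \<in> ?R"
    by (rule UN_I[OF t(1)]) (unfold t(3), use \<alpha>(1) t(2) in blast)
next
  fix \<alpha> :: "nat ^ 'k option" assume "\<alpha> \<in> ?R"
  then obtain t js where "t \<in> {1..h}" "\<alpha> = exp_pair (h - t) (e_vec js)" "length js = 2 * t - 1"
    by blast
  then show "\<alpha> \<in> ?L" by (auto simp: sum_e_vec)
qed

text \<open>a = h leaves the empty list, which the union over t >= 1 omits; hence the extra
  point.\<close>

lemma weight_even_set:
  "{\<alpha> :: nat ^ ('k::finite) option. weight \<alpha> = 2 * h}
    = (\<Union>t\<in>{1..h}. {exp_pair (h - t) (e_vec js) | js. length js = 2 * t}) \<union> {exp_pair h 0}"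
    (is "?L = ?R")
proof (intro equalityI subsetI)
  fix \<alpha> :: "nat ^ 'k option" assume "\<alpha> \<in> ?L"
  then obtain a js where \<alpha>: "\<alpha> = exp_pair a (e_vec js)" "2 * a + length js = 2 * h"
    by (auto simp: weight_eq_iff)
  show "\<alpha> \<in> ?R"
  proof (cases "a = h")
    case True
    with \<alpha>(2) have "js = []" by simp
    then have "e_vec js = 0" by (simp add: e_vec_def vec_eq_iff)
    with \<alpha>(1) True show ?thesis by simp
  next
    case False
    with \<alpha>(2) have t: "h - a \<in> {1..h}" "length js = 2 * (h - a)" "h - (h - a) = a" by auto
    show ?thesis
      by (rule UnI1, rule UN_I[OF t(1)]) (unfold t(3), use \<alpha>(1) t(2) in blast)
  qed
next
  fix \<alpha> :: "nat ^ 'k option" assume "\<alpha> \<in> ?R"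
  then consider "\<alpha> = exp_pair h 0" |
    t js where "t \<in> {1..h}" "\<alpha> = exp_pair (h - t) (e_vec js)" "length js = 2 * t"
    by blast
  then show "\<alpha> \<in> ?L"
  proof cases
    case 1
    then show ?thesis by simp
  next
    case 2
    then show ?thesis by (auto simp: sum_e_vec)
  qed
qed

section \<open>Counting the simple zeros\<close>

lemma differentiable_monom_at: "monom_at \<alpha> differentiable (at (x :: real ^ 'v::finite))"
proof -
  have "(\<lambda>x :: real ^ 'v. \<Prod>i\<in>A. (x $ i) ^ (\<alpha> $ i)) differentiable (at x)" if "finite A" for A
    using that
  proof (induction A rule: finite_induct)
    case (insert i A)
    then show ?case
      by (simp add: differentiable_mult differentiable_power differentiable_vec_nth)
  qed simp
  from this[of UNIV] show ?thesis by (simp add: monom_at_def[abs_def])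
qed

text \<open>The substitution \<rho> = R^2 on exponents. It turns weight into total degree, so that
  the unweighted Bezout bound applies in the variables (R, X).\<close>

definition double_rho :: "nat ^ ('k::finite) option \<Rightarrow> nat ^ 'k option" where
  "double_rho \<alpha> = opt_vec (2 * \<alpha> $ None) (\<lambda>s. \<alpha> $ Some s)"

lemma monom_at_to_rho: "monom_at \<alpha> (to_rho \<eta>) = monom_at (double_rho \<alpha>) \<eta>"
  by (simp add: monom_at_def prod_UNIV_option double_rho_def to_rho_def power_mult)

definition reduced_map :: "('k::finite) params \<Rightarrow> nat \<Rightarrow> real ^ 'k option \<Rightarrow> real ^ 'k option" where
  "reduced_map q m \<eta> = (\<chi> s. eval_poly (averaged_poly q m s) (to_rho \<eta>))"

lemma reduced_map_nth:
  "reduced_map q m \<eta> $ s = (\<Sum>\<alpha>\<in>Poly_Mapping.keys (averaged_poly q m s).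
     Poly_Mapping.lookup (averaged_poly q m s) \<alpha> * monom_at (double_rho \<alpha>) \<eta>)"
  unfolding reduced_map_def monom_at_to_rho[symmetric] vec_lambda_beta
  by (rule eval_poly_superset) auto

lemma differentiable_reduced_map: "reduced_map q m differentiable (at \<eta>)"
proof (rule differentiable_vecI)
  fix i
  show "(\<lambda>\<eta>. reduced_map q m \<eta> $ i) differentiable (at \<eta>)"
    unfolding reduced_map_nth
    by (intro differentiable_sum finite_keys ballI differentiable_mult differentiable_const
        differentiable_monom_at)
qed

definition reflect_R :: "real ^ ('k::finite) option \<Rightarrow> real ^ 'k option" where
  "reflect_R \<eta> = opt_vec (- \<eta> $ None) (\<lambda>s. \<eta> $ Some s)"

lemma reflect_R_reflect_R [simp]: "reflect_R (reflect_R \<eta>) = \<eta>"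
  by (intro vec_option_eqI) (simp_all add: reflect_R_def)

lemma reduced_map_reflect_R [simp]: "reduced_map q m (reflect_R \<eta>) = reduced_map q m \<eta>"
proof -
  have "to_rho (reflect_R \<eta>) = to_rho \<eta>"
    by (intro vec_option_eqI) (simp_all add: to_rho_def reflect_R_def)
  then show ?thesis by (simp add: reduced_map_def)
qed

lemma linear_reflect_R: "linear reflect_R"
  by (intro linearI vec_option_eqI) (simp_all add: reflect_R_def)

text \<open>At a zero the product rule for R/b times g leaves only R/b times g', since the other
  summand contains g(z) = 0. So the derivative of \<open>f1\<close> is that of
  \<open>reduced_map\<close> with each row multiplied by a nonzero constant, and injectivity carries
  over.\<close>

lemma simple_zero_reduced_map:
  assumes b: "par_b q \<noteq> 0" and z: "z \<in> simple_zeros q m"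
  shows "reduced_map q m z = 0"
    and "\<exists>g'. (reduced_map q m has_derivative g') (at z) \<and> inj g'"
proof -
  let ?g = "reduced_map q m"
  let ?k = "\<lambda>(\<eta> :: real ^ 'a option) s. case s of None \<Rightarrow> \<eta> $ None / par_b q | Some _ \<Rightarrow> 1 / par_b q"
  have f1: "f1 q m \<eta> $ s = ?k \<eta> s * ?g \<eta> $ s" for \<eta> s
    unfolding reduced_map_def vec_lambda_beta by (rule f1_eq_averaged_poly)
  have z': "z $ None > 0" "f1 q m z = 0" "det (jacobian (f1 q m) (at z)) \<noteq> 0"
    using z by (auto simp: simple_zeros_def)
  have k: "?k z s \<noteq> 0" for s using b z'(1) by (auto split: option.split)
  have "?g z $ s = 0" for s using f1[of z s] z'(2) k[of s] by simp
  then show gz: "?g z = 0" by (simp add: vec_eq_iff)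
  obtain g' where g': "(?g has_derivative g') (at z)"
    using differentiable_reduced_map unfolding differentiable_def by blast
  define f' where "f' u = (\<chi> s. ?k z s * g' u $ s)" for u
  have "(f1 q m has_derivative f') (at z)"
  proof (rule has_derivative_vecI)
    fix s
    have gs: "((\<lambda>\<eta>. ?g \<eta> $ s) has_derivative (\<lambda>u. g' u $ s)) (at z)"
      by (rule bounded_linear.has_derivative[OF bounded_linear_vec_nth g'])
    show "((\<lambda>\<eta>. f1 q m \<eta> $ s) has_derivative (\<lambda>u. f' u $ s)) (at z)"
    proof (cases s)
      case None
      have "((\<lambda>\<eta>. \<eta> $ None / par_b q) has_derivative (\<lambda>u. u $ None / par_b q)) (at z)"
        by (rule bounded_linear_imp_has_derivative)
          (rule bounded_linear_compose[OF bounded_linear_divide bounded_linear_vec_nth])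
      from has_derivative_mult[OF this gs] show ?thesis
        using gz unfolding f1 f'_def None by simp
    next
      case (Some j)
      from has_derivative_mult_right[OF gs, of "1 / par_b q"] show ?thesis
        unfolding f1 f'_def Some by simp
    qed
  qed
  then have "frechet_derivative (f1 q m) (at z) = f'" "linear f'"
    by (simp_all add: frechet_derivative_at[symmetric] has_derivative_linear)
  then have "inj f'" using z'(3) det_nz_iff_inj[of f'] by (simp add: jacobian_def)
  have "inj g'"
  proof (rule injI)
    fix u v assume "g' u = g' v"
    then have "f' u = f' v" by (simp add: f'_def)
    with \<open>inj f'\<close> show "u = v" by (rule injD)
  qed
  with g' show "\<exists>g'. (?g has_derivative g') (at z) \<and> inj g'" by blast
qed

lemma reduced_map_reflect_R_derivative:
  assumes "(reduced_map q m has_derivative g') (at z)" "inj g'"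
  shows "\<exists>g'. (reduced_map q m has_derivative g') (at (reflect_R z)) \<and> inj g'"
proof -
  have "(reflect_R has_derivative reflect_R) (at (reflect_R z))"
    by (intro bounded_linear_imp_has_derivative linear_linear[THEN iffD2] linear_reflect_R)
  from has_derivative_compose[OF this, of "reduced_map q m" g'] assms(1)
  have "(reduced_map q m has_derivative (\<lambda>u. g' (reflect_R u))) (at (reflect_R z))" by simp
  moreover have "inj (\<lambda>u. g' (reflect_R u))"
  proof (rule injI)
    fix u v assume "g' (reflect_R u) = g' (reflect_R v)"
    then have "reflect_R (reflect_R u) = reflect_R (reflect_R v)"
      using injD[OF assms(2)] by metis
    then show "u = v" by simp
  qed
  ultimately show ?thesis by blast
qed

text \<open>The reduced map is even in \<open>R\<close>, so every zero with \<open>R > 0\<close> counts twice in Bezout's bound.\<close>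

lemma card_simple_zeros_le:
  fixes q :: "('k::finite) params"
  assumes b: "par_b q \<noteq> 0" and m: "m \<ge> 2" and Z: "finite Z" "Z \<subseteq> simple_zeros q m"
  shows "2 * card Z \<le> (m - 1) * m ^ CARD('k)"
proof -
  let ?Z = "Z \<union> reflect_R ` Z"
  have pos: "z $ None > 0" if "z \<in> Z" for z using Z(2) that by (auto simp: simple_zeros_def)
  have inj: "inj_on reflect_R Z" by (metis inj_onI reflect_R_reflect_R)
  have "Z \<inter> reflect_R ` Z = {}"
  proof (rule ccontr)
    assume "Z \<inter> reflect_R ` Z \<noteq> {}"
    then obtain z where "z \<in> Z" "reflect_R z \<in> Z" by auto
    with pos[of z] pos[of "reflect_R z"] show False by (simp add: reflect_R_def)
  qed
  then have "2 * card Z = card ?Z" using Z(1) inj by (simp add: card_Un_disjoint card_image)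
  also have "\<dots> \<le> (\<Prod>i :: 'k option\<in>UNIV. case i of None \<Rightarrow> m - 1 | Some _ \<Rightarrow> m)"
  proof (rule bezout_nondegenerate_zeros)
    show "reduced_map q m x $ i = (\<Sum>\<alpha>\<in>Poly_Mapping.keys (averaged_poly q m i).
        Poly_Mapping.lookup (averaged_poly q m i) \<alpha> * monom_at (double_rho \<alpha>) x)" for x i
      by (rule reduced_map_nth)
    show "(\<Sum>j\<in>UNIV. double_rho \<alpha> $ j) \<le> (case i of None \<Rightarrow> m - 1 | Some _ \<Rightarrow> m)"
      if "\<alpha> \<in> Poly_Mapping.keys (averaged_poly q m i)" for i \<alpha>
    proof (cases i)
      case None
      then have "\<alpha> = 0 \<or> weight \<alpha> = m - 1"
        using that keys_averaged_poly_None[of q m \<alpha>] by (auto simp: in_keys_iff)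
      then show ?thesis using None by (auto simp: double_rho_def sum_UNIV_option)
    next
      case (Some s)
      then have "\<alpha> = axis (Some s) 1 \<or> weight \<alpha> = m"
        using that keys_averaged_poly_Some[of q m s \<alpha>] by (auto simp: in_keys_iff)
      then show ?thesis using Some m by (auto simp: double_rho_def sum_UNIV_option axis_def)
    qed
    show "reduced_map q m z = 0" if "z \<in> ?Z" for z
      using that simple_zero_reduced_map(1)[OF b] Z(2) by auto
    show "\<exists>g'. (reduced_map q m has_derivative g') (at z) \<and> inj g'" if z: "z \<in> ?Z" for z
    proof (cases "z \<in> Z")
      case True
      then show ?thesis using simple_zero_reduced_map(2)[OF b] Z(2) by blast
    next
      case False
      with z obtain y where "y \<in> Z" "z = reflect_R y" by blast
      then show ?thesis
        using simple_zero_reduced_map(2)[OF b, of y] Z(2) reduced_map_reflect_R_derivative by blast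
    qed
  qed (use Z(1) in auto)
  finally show ?thesis by (simp add: prod_UNIV_option)
qed

lemma H1_le:
  assumes m: "m \<ge> 2"
  shows "H1 TYPE('k::finite) m \<le> enat ((m - 1) * m ^ CARD('k) div 2)"
  unfolding H1_def
proof (rule Sup_least, clarify)
  fix q :: "'k params"
  assume b: "par_b q \<noteq> 0"
  let ?B = "(m - 1) * m ^ CARD('k) div 2"
  \<comment> \<open>Finiteness is not known in advance; a uniform bound on the finite subsets yields
    it together with the count.\<close>
  have "finite (simple_zeros q m) \<and> card (simple_zeros q m) \<le> ?B"
  proof (rule finite_if_finite_subsets_card_bdd)
    fix Z assume "Z \<subseteq> simple_zeros q m" "finite Z"
    with card_simple_zeros_le[OF b m] show "card Z \<le> ?B" by fastforce
  qed
  then show "ecard (simple_zeros q m) \<le> enat ?B" by (simp add: ecard_def)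
qed

section \<open>The mixed volume of the supports\<close>

lemma hull_int_int_exps:
  "hull_int (int_exps A) = convex hull ((\<lambda>\<alpha>. \<chi> i. real (\<alpha> $ i)) ` A)"
  by (simp add: hull_int_def int_exps_def image_image)

text \<open>The vertices of the truncated simplex are lattice points exactly because the truncation
  parameter is the parity of the weighted degree.\<close>

lemma MV_supports:
  fixes A :: "('k::finite) option \<Rightarrow> (nat ^ 'k option) set"
  assumes m: "m \<ge> 2"
    and A: "A None = {0} \<union> {\<alpha>. weight \<alpha> = m - 1}"
      "\<And>s. A (Some s) = {0} \<union> ({axis (Some s) 1} \<union> {\<alpha>. weight \<alpha> = m})"
  shows "MV (\<lambda>s. int_exps (A s)) = real ((m - 1) * m ^ CARD('k)) / 2"
proof -
  define T where "T i = (case i of None \<Rightarrow> m - 1 | Some _ \<Rightarrow> m)" for i :: "'k option"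
  \<comment> \<open>z = 0 leaves the even sizes uncut. c + 1 is the odd one of m - 1 and m, so T -
    (c + 1) z = 0 whenever T is odd, and the cut passes through the origin.\<close>
  define z where "z i = T i mod 2" for i
  define c where "c = (if even m then m - 2 else m - 1)"
  have odd_T: "T i = c + 1" if "odd (T i)" for i
    using that m by (cases i) (auto simp: T_def c_def)
  have T_le: "T i \<le> c + 2" "1 \<le> T i" for i
    using m by (auto simp: T_def c_def split: option.split)
  have cz: "(c + 1) * z i \<le> T i" for i
    using odd_T[of i] by (cases "odd (T i)") (auto simp: z_def odd_iff_mod_2_eq_one)
  let ?r = "\<lambda>\<alpha> :: nat ^ 'k option. (\<chi> i. real (\<alpha> $ i)) :: real ^ 'k option"
  let ?H = "\<lambda>i. hull_int (int_exps (A i))"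
  have mem: "?r \<alpha> \<in> ?H i" if "\<alpha> = 0 \<or> weight \<alpha> = T i" for \<alpha> i
    unfolding hull_int_int_exps
    by (rule hull_inc) (use that A in \<open>auto simp: T_def split: option.splits\<close>)
  have r_opt: "?r (opt_vec a b) = opt_vec (real a) (\<lambda>s. real (b s))" for a b
    by (intro vec_option_eqI) auto
  have delta: "(\<lambda>s. real (delta j t s)) = delta j (real t)" for j :: 'k and t
    by (auto simp: delta_def)
  have sum_delta: "(\<Sum>s\<in>UNIV. delta j t s) = t" for j :: 'k and t :: nat
    by (simp add: delta_def)
  have half: "(real (T i) - real (z i)) / 2 = real (T i div 2)" for i
  proof -
    have "T i = 2 * (T i div 2) + z i" by (simp add: z_def)
    then have "real (T i) = 2 * real (T i div 2) + real (z i)" by (metis of_nat_add of_nat_mult of_nat_numeral)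
    then show ?thesis by simp
  qed
  have "MV (\<lambda>s. int_exps (A s)) =
      ((\<Prod>i\<in>UNIV. real (T i)) - (real c + 1) * (\<Prod>i\<in>UNIV. real (z i))) / 2"
  proof (rule MV_trunc_simplex)
    show "(real c + 1) * real (z i) \<le> real (T i)" for i
    proof -
      have "real ((c + 1) * z i) \<le> real (T i)" using cz[of i] by (simp only: of_nat_le_iff)
      then show ?thesis by (simp add: algebra_simps)
    qed
    then have pos: "0 \<le> real (T i) - (real c + 1) * real (z i)" for i by simp
    show "?H i \<subseteq> trunc_simplex (real c) (real (T i)) (real (z i))" for i
      unfolding hull_int_int_exps
    proof (rule hull_minimal, clarify)
      show "convex (trunc_simplex (real c) (real (T i)) (real (z i)) :: (real ^ 'k option) set)"
        by (rule convex_trunc_simplex)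
      fix \<alpha> assume "\<alpha> \<in> A i"
      then consider "\<alpha> = 0" | "weight \<alpha> = T i" | s where "i = Some s" "\<alpha> = axis (Some s) 1"
        using A by (cases i) (auto simp: T_def)
      then show "?r \<alpha> \<in> trunc_simplex (real c) (real (T i)) (real (z i))"
      proof cases
        case 1
        then show ?thesis using pos[of i] by (simp add: trunc_simplex_def wsimplex_def)
      next
        case 2
        \<comment> \<open>If the weight is odd, so is the tail sum, since \<rho> contributes an even
          amount.\<close>
        have "z i \<le> tail \<alpha>"
        proof (cases "odd (T i)")
          case True
          with 2 have "odd (tail \<alpha>)" by (metis even_add even_mult_iff even_numeral)
          then have "tail \<alpha> \<ge> 1" by (simp add: odd_pos Suc_leI)
          then show ?thesis using True by (simp add: z_def odd_iff_mod_2_eq_one)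
        qed (simp add: z_def)
        then have "real (z i) \<le> real (tail \<alpha>)" by (simp only: of_nat_le_iff)
        then have "(real c + 1) * real (z i) \<le> (real c + 1) * real (tail \<alpha>)"
          by (rule mult_left_mono) simp
        moreover have "2 * real (\<alpha> $ None) + real (tail \<alpha>) = real (T i)"
          using 2 by (metis of_nat_add of_nat_mult of_nat_numeral)
        ultimately show ?thesis
          by (simp add: trunc_simplex_def wsimplex_def algebra_simps)
      next
        case 3
        have "tail \<alpha> = 1" using 3(2) by (simp add: axis_def)
        then have "(\<Sum>s\<in>UNIV. real (\<alpha> $ Some s)) = 1" by (metis of_nat_1 of_nat_sum)
        moreover have "\<alpha> $ None = 0" using 3(2) by (simp add: axis_def)
        ultimately show ?thesis
          using pos[of i] T_le(2)[of i] by (simp add: trunc_simplex_def wsimplex_def)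
      qed
    qed
    show "0 \<in> ?H i" for i
    proof -
      have "?r 0 = 0" by (simp add: vec_eq_iff)
      with mem[of 0 i] show ?thesis by simp
    qed
    show "opt_vec 0 (delta j (real (T i))) \<in> ?H i" for i j
      using mem[of "opt_vec 0 (delta j (T i))" i] unfolding r_opt delta by (simp add: sum_delta)
    show "opt_vec ((real (T i) - real (z i)) / 2) (delta j (real (z i))) \<in> ?H i" for i j
      using mem[of "opt_vec (T i div 2) (delta j (z i))" i] unfolding r_opt delta half
      by (simp add: sum_delta z_def)
    \<comment> \<open>For odd size this vertex is the origin, for even size the lattice point (T/2,
      0).\<close>
    show "opt_vec ((real (T i) - (real c + 1) * real (z i)) / 2) (\<lambda>_. 0) \<in> ?H i" for i
    proof (cases "odd (T i)")
      case True
      then have "real (T i) - (real c + 1) * real (z i) = 0"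
        using odd_T[of i] by (simp add: z_def odd_iff_mod_2_eq_one)
      moreover have "opt_vec 0 (\<lambda>_. 0) = ?r 0" by (intro vec_option_eqI) auto
      ultimately show ?thesis using mem[of 0 i] by simp
    next
      case False
      then have "z i = 0" by (simp add: z_def)
      then have "(real (T i) - (real c + 1) * real (z i)) / 2 = real (T i div 2)"
        using half[of i] by simp
      moreover have "2 * (T i div 2) = T i" using False by simp
      ultimately show ?thesis
        using mem[of "opt_vec (T i div 2) (\<lambda>_. 0)" i] unfolding r_opt by simp
    qed
  qed simp_all
  moreover have "(\<Prod>i\<in>UNIV. real (z i)) = 0"
  proof -
    \<comment> \<open>For odd m the even size m - 1 sits at \<open>None\<close>; for even m the even
      size m sits at every \<open>Some s\<close>, and such an s exists because types are
      nonempty.\<close>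
    have "z None = 0 \<or> z (Some s) = 0" for s :: 'k
      using m by (cases "even m") (auto simp: z_def T_def)
    then show ?thesis by (auto simp: prod_zero_iff)
  qed
  ultimately show ?thesis by (simp add: T_def prod_UNIV_option)
qed

theorem theorem8:
  fixes n m :: nat
  assumes "n \<ge> 3" and "m \<ge> 2" and "CARD('k::finite) = n - 2"
  shows "ereal_of_enat (H1 TYPE('k) m) \<le>
           ereal (MV (\<lambda>s :: 'k option. int_exps
             (case s of None \<Rightarrow> supp_gen m None | Some j \<Rightarrow> {0} \<union> supp_gen m (Some j))))
    \<and> (even m \<longrightarrow>
         supp_gen m (None :: 'k option) =
           (\<Union>t\<in>{1..m div 2}. {exp_pair (m div 2 - t) (e_vec js) | js. length js = 2 * t - 1})
             \<union> {0}
       \<and> (\<forall>s :: 'k. supp_gen m (Some s) =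
           (\<Union>t\<in>{1..m div 2}. {exp_pair (m div 2 - t) (e_vec js) | js. length js = 2 * t})
             \<union> {axis (Some s) 1} \<union> {exp_pair (m div 2) 0}))
    \<and> (odd m \<longrightarrow>
         supp_gen m (None :: 'k option) =
           (\<Union>t\<in>{1..(m - 1) div 2}. {exp_pair ((m - 1) div 2 - t) (e_vec js) | js. length js = 2 * t})
             \<union> {0} \<union> {exp_pair ((m - 1) div 2) 0}
       \<and> (\<forall>s :: 'k. supp_gen m (Some s) =
           (\<Union>t\<in>{1..(m + 1) div 2}. {exp_pair ((m + 1) div 2 - t) (e_vec js) | js. length js = 2 * t - 1})
             \<union> {axis (Some s) 1}))"
proof (intro conjI impI)
  note supp = supp_gen_None[OF assms(2), where ?'k = 'k] supp_gen_Some[OF assms(2), where ?'k = 'k]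
  let ?A = "\<lambda>s :: 'k option. case s of None \<Rightarrow> supp_gen m None | Some j \<Rightarrow> {0} \<union> supp_gen m (Some j)"
  let ?b = "(m - 1) * m ^ CARD('k)"
  have "ereal_of_enat (H1 TYPE('k) m) \<le> ereal_of_enat (enat (?b div 2))"
    using H1_le[OF assms(2), where ?'k = 'k] by (simp only: ereal_of_enat_le_iff)
  also have "\<dots> \<le> ereal (real ?b / 2)"
  proof -
    have "2 * (?b div 2) \<le> ?b" by simp
    then have "real (2 * (?b div 2)) \<le> real ?b" by (simp only: of_nat_le_iff)
    then have "real (?b div 2) \<le> real ?b / 2" unfolding of_nat_mult by linarith
    then show ?thesis by (simp only: ereal_of_enat_simps ereal_less_eq)
  qed
  also have "real ?b / 2 = MV (\<lambda>s. int_exps (?A s))"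
    by (rule MV_supports[OF assms(2), symmetric]) (simp_all add: supp)
  finally show "ereal_of_enat (H1 TYPE('k) m) \<le> ereal (MV (\<lambda>s. int_exps (?A s)))" .
  {
    assume "even m"
    then have m: "m = 2 * (m div 2)" "m - 1 = 2 * (m div 2) - 1" "m div 2 \<ge> 1" using assms(2) by auto
    show "supp_gen m (None :: 'k option) =
        (\<Union>t\<in>{1..m div 2}. {exp_pair (m div 2 - t) (e_vec js) | js. length js = 2 * t - 1}) \<union> {0}"
      unfolding supp weight_odd_set[OF m(3), symmetric] m(2) by (rule Un_commute)
    have "{\<alpha> :: nat ^ 'k option. weight \<alpha> = m} = {\<alpha>. weight \<alpha> = 2 * (m div 2)}" using m(1) by simp
    then show "\<forall>s :: 'k. supp_gen m (Some s) =
        (\<Union>t\<in>{1..m div 2}. {exp_pair (m div 2 - t) (e_vec js) | js. length js = 2 * t})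
          \<union> {axis (Some s) 1} \<union> {exp_pair (m div 2) 0}"
      unfolding supp weight_even_set by blast
  next
    assume "odd m"
    then have m: "m - 1 = 2 * ((m - 1) div 2)" "m = 2 * ((m + 1) div 2) - 1" "(m + 1) div 2 \<ge> 1"
      using assms(2) by (auto elim!: oddE)
    have "{\<alpha> :: nat ^ 'k option. weight \<alpha> = m - 1} = {\<alpha>. weight \<alpha> = 2 * ((m - 1) div 2)}"
      using m(1) by simp
    then show "supp_gen m (None :: 'k option) =
        (\<Union>t\<in>{1..(m - 1) div 2}. {exp_pair ((m - 1) div 2 - t) (e_vec js) | js. length js = 2 * t})
          \<union> {0} \<union> {exp_pair ((m - 1) div 2) 0}"
      unfolding supp weight_even_set by blast
    have "{\<alpha> :: nat ^ 'k option. weight \<alpha> = m} = {\<alpha>. weight \<alpha> = 2 * ((m + 1) div 2) - 1}"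
      using m(2) by simp
    then show "\<forall>s :: 'k. supp_gen m (Some s) =
        (\<Union>t\<in>{1..(m + 1) div 2}. {exp_pair ((m + 1) div 2 - t) (e_vec js) | js. length js = 2 * t - 1})
          \<union> {axis (Some s) 1}"
      unfolding supp weight_odd_set[OF m(3)] by (simp add: Un_commute)
  }
qed

end
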